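(* Let $k$ be a field with an endomorphism $\alpha$ and an $\alpha$-derivation $\delta$, let $R=k[x;\alpha,\delta]$ be the associated left skew polynomial ring, let $Q$ be its skew field of fractions, and let $n\geq 1$. Let $\deg\det:\mathrm{M}(n,Q)\to\mathbb{Z}\cup\{\infty\}$ be the composition of the Dieudonné determinant with the degree map. Then: (1) The restriction of $\deg\det$ to $\mathrm{M}(n,R)$ induces an exact sequence of unitary semigroups $$1\to \mathrm{GL}(n,R)\to \mathrm{M}(n,R)\xrightarrow{\ \deg\det\ }\mathbb{N}\cup\{\infty\}\to 0 .$$ That is, $\deg\det$ maps $\mathrm{M}(n,R)$ onto $\mathbb{N}\cup\{\infty\}$, it satisfies $\deg\det(AB)=\deg\det(A)+\deg\det(B)$ and $\deg\det(1)=0$, and for $A\in \mathrm{M}(n,R)$ one has $\deg\det(A)=0$ if and only if $A\in\mathrm{GL}(n,R)$. (2) Every semigroup homomorphism $f:\mathrm{M}(n,R)\to\mathbb{Z}\cup\{\infty\}$ (that is, every map with $f(AB)=f(A)+f(B)$ for all $A,B\in\mathrm{M}(n,R)$) that coincides with $\deg\det$ on the diagonal matrices $\mathrm{D}(n,R)$ equals $\deg\det$ on $\mathrm{M}(n,R)$.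
   Context: Fields are commutative; $\mathbb{N}=\{0,1,2,\dots\}$. Let $k$ be a field with an endomorphism $\alpha:k\to k$, $a\mapsto a^\alpha$ (not necessarily surjective). An $\alpha$-derivation is an additive map $\delta:k\to k$, $a\mapsto a^\delta$, such that $(ab)^\delta=a^\delta b^\alpha+ab^\delta$. The left skew polynomial ring $R=k[x;\alpha,\delta]$ consists of the expressions $a_0+a_1x+\dots+a_mx^m$ with $a_i\in k$, with the usual addition, and with multiplication determined by the commutation rule $xa=a^\alpha x+a^\delta$ for $a\in k$. It carries the usual degree map $\deg:R\setminus\{0\}\to\mathbb{N}$. The ring $R$ is a left principal ideal domain, hence left Ore, and has a unique skew field of fractions $Q$, consisting of the fractions $r/s$ (meaning $s^{-1}r$) with $r,s\in R$, $s\neq0$, where $r/s=r'/s'$ if and only if there are non-zero $u,u'\in R$ with $ur=u'r'$ and $us=u's'$. The degree extends to a well-defined map $\deg:Q\to\mathbb{Z}\cup\{\infty\}$, $\deg(r/s)=\deg(r)-\deg(s)$, with $\deg(0)=\infty$, satisfying $\deg(tu)=\deg(t)+\deg(u)$. It factors through $Q^{\mathrm{ab}}:=Q^\times/[Q^\times,Q^\times]\cup\{0\}$. For a ring $S$: $\mathrm{M}(n,S)$ is the ring of $n\times n$ matrices over $S$, regarded as a semigroup with unit under multiplication; $\mathrm{GL}(n,S)$ is its group of invertible elements; $\mathrm{D}(n,S)\subset \mathrm{M}(n,S)$ is the subring of diagonal matrices. The sets $\mathbb{N}\cup\{\infty\}$ and $\mathbb{Z}\cup\{\infty\}$ are semigroups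 under addition, with $\infty+a=a+\infty=\infty$ for all $a$. The Dieudonné determinant is the multiplicative map $\det:\mathrm{M}(n,Q)\to Q^{\mathrm{ab}}$ that sends non-invertible matrices to $0$, elementary matrices to $1$, and $\mathrm{diag}(1,\dots,1,q)$ with $q\in Q^\times$ to the class of $q$. Then $\deg\det(A)$ is the degree of $\det(A)\in Q^{\mathrm{ab}}$. *)

theory Defs
  imports
    "HOL-Algebra.Generated_Groups"
    "HOL-Algebra.Ring"
    "HOL-Library.Extended"
    "HOL-Computational_Algebra.Polynomial"
    "Jordan_Normal_Form.Matrix"
begin

subsection \<open>Left skew polynomial rings\<close>

definition alpha_derivation :: "('k::field \<Rightarrow> 'k) \<Rightarrow> ('k \<Rightarrow> 'k) \<Rightarrow> bool" where
  "alpha_derivation \<alpha> \<delta> \<longleftrightarrow>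
     (\<forall>a b. \<delta> (a + b) = \<delta> a + \<delta> b) \<and>
     (\<forall>a b. \<delta> (a * b) = \<delta> a * \<alpha> b + a * \<delta> b)"

text \<open>
  The expression \<open>a\<^sub>0 + a\<^sub>1 x + \<dots> + a\<^sub>m x\<^sup>m\<close> is represented by the ordinary polynomial with
  coefficients \<open>a\<^sub>0, \<dots>, a\<^sub>m\<close>; only the multiplication differs from the one of the type
  \<open>'k poly\<close>. Left multiplication by \<open>x\<close> is
  \<open>x (\<Sum>\<^sub>j b\<^sub>j x\<^sup>j) = \<Sum>\<^sub>j (\<alpha>(b\<^sub>j) x + \<delta>(b\<^sub>j)) x\<^sup>j\<close>.
\<close>

definition skew_X_mult ::
  "('k::field \<Rightarrow> 'k) \<Rightarrow> ('k \<Rightarrow> 'k) \<Rightarrow> 'k poly \<Rightarrow> 'k poly" where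
  "skew_X_mult \<alpha> \<delta> q = pCons 0 (map_poly \<alpha> q) + map_poly \<delta> q"

definition skew_mult ::
  "('k::field \<Rightarrow> 'k) \<Rightarrow> ('k \<Rightarrow> 'k) \<Rightarrow> 'k poly \<Rightarrow> 'k poly \<Rightarrow> 'k poly" where
  "skew_mult \<alpha> \<delta> p q = (\<Sum>i\<le>degree p. Polynomial.smult (coeff p i) ((skew_X_mult \<alpha> \<delta> ^^ i) q))"

definition skew_poly_ring ::
  "('k::field \<Rightarrow> 'k) \<Rightarrow> ('k \<Rightarrow> 'k) \<Rightarrow> 'k poly ring" where
  "skew_poly_ring \<alpha> \<delta> =
     \<lparr>carrier = UNIV, monoid.mult = skew_mult \<alpha> \<delta>, one = 1, zero = 0, add = (+)\<rparr>"

lemma skew_commutation_rule: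
  assumes "field_hom \<alpha>" and "alpha_derivation \<alpha> \<delta>"
  shows "[:0, 1:] \<otimes>\<^bsub>skew_poly_ring \<alpha> \<delta>\<^esub> [:a:] = [:\<delta> a, \<alpha> a:]"
proof -
  interpret field_hom \<alpha> by fact
  from assms(2) have "\<delta> (0 + 0) = \<delta> 0 + \<delta> 0"
    unfolding alpha_derivation_def by blast
  then have "\<delta> 0 = 0" by (metis add_0 add_cancel_right_right)
  then show ?thesis
    by (simp add: skew_poly_ring_def skew_mult_def skew_X_mult_def map_poly_pCons)
qed

lemma skew_poly_ring_is_ring:
  assumes "field_hom \<alpha>" and "alpha_derivation \<alpha> \<delta>"
  shows "ring (skew_poly_ring \<alpha> \<delta>)"
proof -
  interpret field_hom \<alpha> by fact
  have d_add: "\<delta> (a + b) = \<delta> a + \<delta> b" and d_mult: "\<delta> (a * b) = \<delta> a * \<alpha> b + a * \<delta> b" for a b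
    using assms(2) unfolding alpha_derivation_def by blast+
  have d0: "\<delta> 0 = 0" using d_add[of 0 0] by (metis add_0 add_cancel_right_right)
  have d1: "\<delta> 1 = 0" using d_mult[of 1 1] by (metis add_cancel_right_right hom_one mult_1 mult.right_neutral)
  define T where "T = skew_X_mult \<alpha> \<delta>"
  define M where "M = skew_mult \<alpha> \<delta>"
  have d_mult': "\<delta> (a * b) = \<alpha> a * \<delta> b + \<delta> a * b" for a b
    using d_mult[of b a] by (simp add: mult.commute)
  have coeff_T: "coeff (T q) j = (case j of 0 \<Rightarrow> 0 | Suc i \<Rightarrow> \<alpha> (coeff q i)) + \<delta> (coeff q j)" for q j
    by (simp add: T_def skew_X_mult_def coeff_map_poly d0 coeff_pCons split: nat.split)
  have T_add: "T (p + q) = T p + T q" for p q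
    by (intro poly_eqI) (simp add: coeff_T d_add hom_add split: nat.split)
  have T_smult: "T (Polynomial.smult a q) =
      Polynomial.smult (\<alpha> a) (T q) + Polynomial.smult (\<delta> a) q" for a q
    by (intro poly_eqI) (simp add: coeff_T d_mult' hom_mult algebra_simps split: nat.split)
  have T0: "T 0 = 0" using T_add[of 0 0] by (metis add_0 add_cancel_right_right)
  have Tn_add: "(T ^^ i) (p + q) = (T ^^ i) p + (T ^^ i) q" for i p q
    by (induction i) (simp_all add: T_add)
  have Tn_0: "(T ^^ i) 0 = 0" for i by (induction i) (simp_all add: T0)
  have M_ge: "M p q = (\<Sum>i\<le>N. Polynomial.smult (coeff p i) ((T ^^ i) q))" if "degree p \<le> N" for p q N
    unfolding M_def skew_mult_def T_def[symmetric] using that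
    by (intro sum.mono_neutral_left) (auto simp: coeff_eq_0)
  have M_add_left: "M (p + q) r = M p r + M q r" for p q r
  proof -
    let ?N = "max (degree p) (degree q)"
    show ?thesis
      by (subst (1 2 3) M_ge[of _ ?N]) (auto simp: degree_add_le smult_add_left sum.distrib)
  qed
  have M_add_right: "M r (p + q) = M r p + M r q" for p q r
    unfolding M_def skew_mult_def T_def[symmetric]
    by (simp add: Tn_add smult_add_right sum.distrib)
  have M_0_left: "M 0 r = 0" for r by (simp add: M_def skew_mult_def)
  have M_0_right: "M r 0 = 0" for r
    unfolding M_def skew_mult_def T_def[symmetric] by (simp add: Tn_0)
  have smult_sum_right: "Polynomial.smult a (sum f S) = (\<Sum>i\<in>S. Polynomial.smult a (f i))"
    for a and f :: "nat \<Rightarrow> 'a poly" and S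
    by (induction S rule: infinite_finite_induct) (simp_all add: smult_add_right)
  have M_smult: "M (Polynomial.smult a p) q = Polynomial.smult a (M p q)" for a p q
    by (subst (1 2) M_ge[of _ "degree p"])
       (auto simp: smult_sum_right degree_smult_le)
  have M_X: "M (pCons 0 p) q = M p (T q)" for p q
  proof -
    have "M (pCons 0 p) q = (\<Sum>i\<le>Suc (degree p). Polynomial.smult (coeff (pCons 0 p) i) ((T ^^ i) q))"
      by (rule M_ge) (rule degree_pCons_le)
    also have "\<dots> = (\<Sum>i\<le>degree p. Polynomial.smult (coeff p i) ((T ^^ Suc i) q))"
      by (subst sum.atMost_Suc_shift) simp
    also have "\<dots> = M p (T q)"
      unfolding M_ge[OF order_refl] by (simp only: funpow_Suc_right o_apply)
    finally show ?thesis .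
  qed
  have M_const: "M [:a:] q = Polynomial.smult a q" for a q
    by (simp add: M_def skew_mult_def)
  have M_pCons: "M (pCons a p) q = Polynomial.smult a q + M p (T q)" for a p q
    using M_add_left[of "[:a:]" "pCons 0 p" q] by (simp add: M_const M_X)
  have T_pCons: "T (pCons a p) = pCons (\<delta> a) [:\<alpha> a:] + pCons 0 (T p)" for a p
    by (intro poly_eqI) (simp add: coeff_T coeff_pCons d0 split: nat.split)
  have T_M: "T (M p q) = M (T p) q" for p q
  proof (induction p arbitrary: q)
    case 0
    then show ?case by (simp add: M_0_left T0)
  next
    case (pCons a p)
    have "T (M (pCons a p) q) =
        Polynomial.smult (\<alpha> a) (T q) + Polynomial.smult (\<delta> a) q + M (T p) (T q)"
      by (simp only: M_pCons T_add T_smult pCons.IH)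
    also have "\<dots> = M (T (pCons a p)) q"
      by (simp add: T_pCons M_add_left M_pCons M_const M_0_left)
    finally show ?case .
  qed
  have M_assoc: "M (M p q) r = M p (M q r)" for p q r
  proof (induction p arbitrary: q)
    case 0
    then show ?case by (simp add: M_0_left)
  next
    case (pCons a p)
    then show ?case by (simp add: M_pCons M_add_left M_smult T_M)
  qed
  have T1: "(T ^^ i) 1 = monom 1 i" for i
  proof (induction i)
    case (Suc i)
    then show ?case
      by (auto intro!: poly_eqI simp: coeff_T d0 d1 split: nat.split)
  qed simp
  have M_1_right: "M p 1 = p" for p
    unfolding M_def skew_mult_def T_def[symmetric]
    by (simp add: T1 smult_monom poly_as_sum_of_monoms)
  have M_1_left: "M 1 p = p" for p
    by (simp add: M_def skew_mult_def)
  show ?thesis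
    unfolding skew_poly_ring_def M_def[symmetric]
  proof (rule ringI, goal_cases)
    case 1
    show ?case
    proof (rule abelian_groupI, goal_cases)
      case (6 x)
      show ?case by (rule bexI[of _ "- x"]) simp_all
    qed (auto simp: algebra_simps)
  next
    case 2
    show ?case by (rule monoidI) (auto simp: M_assoc M_1_left M_1_right)
  qed (auto simp: M_add_left M_add_right)
qed

subsection \<open>Skew fields of fractions\<close>

definition is_skew_field :: "'q ring \<Rightarrow> bool" where
  "is_skew_field Q \<longleftrightarrow> ring Q \<and> Units Q = carrier Q - {\<zero>\<^bsub>Q\<^esub>}"

definition fraction :: "'q ring \<Rightarrow> ('r \<Rightarrow> 'q) \<Rightarrow> 'r \<Rightarrow> 'r \<Rightarrow> 'q" where
  "fraction Q \<iota> r s = inv\<^bsub>Q\<^esub> (\<iota> s) \<otimes>\<^bsub>Q\<^esub> \<iota> r"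

definition is_skew_field_of_fractions ::
  "'r ring \<Rightarrow> 'q ring \<Rightarrow> ('r \<Rightarrow> 'q) \<Rightarrow> bool" where
  "is_skew_field_of_fractions R Q \<iota> \<longleftrightarrow>
     is_skew_field Q \<and> \<iota> \<in> Ring.ring_hom R Q \<and> inj_on \<iota> (carrier R) \<and>
     carrier Q = {fraction Q \<iota> r s | r s. r \<in> carrier R \<and> s \<in> carrier R \<and> s \<noteq> \<zero>\<^bsub>R\<^esub>}"

subsection \<open>The degree, with values in \<open>\<int> \<union> {\<infinity>}\<close>\<close>

text \<open>
  The type \<open>int extended\<close> also contains \<open>-\<infinity>\<close>, so the codomains are given as sets.
\<close>

definition int_inf :: "int extended set" where
  "int_inf = range Fin \<union> {\<infinity>}"

definition nat_inf :: "int extended set" where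
  "nat_inf = range (\<lambda>m::nat. Fin (int m)) \<union> {\<infinity>}"

definition frac_deg ::
  "'q ring \<Rightarrow> ('k::field poly \<Rightarrow> 'q) \<Rightarrow> 'q \<Rightarrow> int extended" where
  "frac_deg Q \<iota> q =
     (if q = \<zero>\<^bsub>Q\<^esub> then \<infinity>
      else Fin (THE d. \<exists>r s. r \<noteq> 0 \<and> s \<noteq> 0 \<and> q = fraction Q \<iota> r s \<and>
                         d = int (degree r) - int (degree s)))"

text \<open>
  The class of \<open>q \<noteq> 0\<close> in \<open>Q\<^sup>a\<^sup>b\<close> is its coset modulo the commutator subgroup of the group of
  units; the element \<open>0\<close> of \<open>Q\<^sup>a\<^sup>b\<close> is represented by the set \<open>{0}\<close>. With this
  encoding \<open>set_mult\<close> is the multiplication also for \<open>0\<close>.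
\<close>

definition commutator_units :: "'q ring \<Rightarrow> 'q set" where
  "commutator_units Q = derived (units_of Q) (carrier (units_of Q))"

definition ab_class :: "'q ring \<Rightarrow> 'q \<Rightarrow> 'q set" where
  "ab_class Q q =
     (if q = \<zero>\<^bsub>Q\<^esub> then {\<zero>\<^bsub>Q\<^esub>} else commutator_units Q #>\<^bsub>units_of Q\<^esub> q)"

definition Q_ab :: "'q ring \<Rightarrow> 'q set monoid" where
  "Q_ab Q =
     \<lparr>carrier = carrier (units_of Q Mod commutator_units Q) \<union> {{\<zero>\<^bsub>Q\<^esub>}},
      monoid.mult = set_mult Q,
      one = commutator_units Q\<rparr>"

definition ab_deg ::
  "'q ring \<Rightarrow> ('k::field poly \<Rightarrow> 'q) \<Rightarrow> 'q set \<Rightarrow> int extended" where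
  "ab_deg Q \<iota> C = the_elem (frac_deg Q \<iota> ` C)"

subsection \<open>Matrices\<close>

definition matrix_ring :: "nat \<Rightarrow> 's ring \<Rightarrow> 's mat ring" where
  "matrix_ring n S =
     \<lparr>carrier = {A \<in> carrier_mat n n. \<forall>i<n. \<forall>j<n. A $$ (i, j) \<in> carrier S},
      monoid.mult = (\<lambda>A B. mat n n (\<lambda>(i, j). \<Oplus>\<^bsub>S\<^esub>k\<in>{..<n}. A $$ (i, k) \<otimes>\<^bsub>S\<^esub> B $$ (k, j))),
      one = mat n n (\<lambda>(i, j). if i = j then \<one>\<^bsub>S\<^esub> else \<zero>\<^bsub>S\<^esub>),
      zero = mat n n (\<lambda>_. \<zero>\<^bsub>S\<^esub>),
      add = (\<lambda>A B. mat n n (\<lambda>(i, j). A $$ (i, j) \<oplus>\<^bsub>S\<^esub> B $$ (i, j)))\<rparr>"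

definition GL :: "nat \<Rightarrow> 's ring \<Rightarrow> 's mat set" where
  "GL n S = Units (matrix_ring n S)"

definition diagonal_matrices :: "nat \<Rightarrow> 's ring \<Rightarrow> 's mat set" where
  "diagonal_matrices n S =
     {A \<in> carrier (matrix_ring n S). \<forall>i<n. \<forall>j<n. i \<noteq> j \<longrightarrow> A $$ (i, j) = \<zero>\<^bsub>S\<^esub>}"

definition elementary_matrix :: "nat \<Rightarrow> 's ring \<Rightarrow> nat \<Rightarrow> nat \<Rightarrow> 's \<Rightarrow> 's mat" where
  "elementary_matrix n S i j c =
     mat n n (\<lambda>(k, l). if k = l then \<one>\<^bsub>S\<^esub> else if k = i \<and> l = j then c else \<zero>\<^bsub>S\<^esub>)"

definition last_diag_matrix :: "nat \<Rightarrow> 's ring \<Rightarrow> 's \<Rightarrow> 's mat" where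
  "last_diag_matrix n S q =
     mat n n (\<lambda>(k, l). if k \<noteq> l then \<zero>\<^bsub>S\<^esub> else if k = n - 1 then q else \<one>\<^bsub>S\<^esub>)"

subsection \<open>The Dieudonne determinant\<close>

text \<open>
  Since every invertible matrix over a skew field is the product of elementary matrices and
  a matrix \<open>diag(1, \<dots>, 1, q)\<close>, the following properties determine the values of \<open>D\<close> on
  all \<open>n \<times> n\<close> matrices.
\<close>

definition is_dieudonne_det ::
  "nat \<Rightarrow> 'q ring \<Rightarrow> ('q mat \<Rightarrow> 'q set) \<Rightarrow> bool" where
  "is_dieudonne_det n Q D \<longleftrightarrow>
     D \<in> hom (matrix_ring n Q) (Q_ab Q) \<and>
     (\<forall>A \<in> carrier (matrix_ring n Q) - GL n Q. D A = ab_class Q \<zero>\<^bsub>Q\<^esub>) \<and>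
     (\<forall>i<n. \<forall>j<n. \<forall>c \<in> carrier Q. i \<noteq> j \<longrightarrow>
        D (elementary_matrix n Q i j c) = \<one>\<^bsub>Q_ab Q\<^esub>) \<and>
     (\<forall>q \<in> Units Q. D (last_diag_matrix n Q q) = ab_class Q q)"

definition deg_det ::
  "'q ring \<Rightarrow> ('k::field poly \<Rightarrow> 'q) \<Rightarrow> ('q mat \<Rightarrow> 'q set) \<Rightarrow> 'q mat \<Rightarrow> int extended" where
  "deg_det Q \<iota> D A = ab_deg Q \<iota> (D A)"

text \<open>
  The restriction of \<open>deg det\<close> to matrices over \<open>R\<close>, which are regarded as matrices over
  \<open>Q\<close> by applying the embedding \<open>\<iota>\<close> to all entries.
\<close>

definition deg_det_restr ::
  "'q ring \<Rightarrow> ('k::field poly \<Rightarrow> 'q) \<Rightarrow> ('q mat \<Rightarrow> 'q set) \<Rightarrow> 'k poly mat \<Rightarrow> int extended" where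
  "deg_det_restr Q \<iota> D A = deg_det Q \<iota> D (map_mat \<iota> A)"

end

theory Submission
  imports Defs
begin

text \<open>
  Right division with remainder in \<open>R\<close> makes every square matrix over \<open>R\<close> a product of
  elementary matrices and of diagonal matrices \<open>diag(1, \<dots>, 1, d, 1, \<dots>, 1)\<close>, with \<open>d = 0\<close>
  allowed: row operations clear a column below its diagonal entry \<open>d\<close>, the factor with entry
  \<open>d\<close> splits off on the right, and column operations then clear the row.
  On these generators \<open>deg det\<close> is \<open>0\<close> and \<open>deg d\<close>, so its values lie in
  \<open>\<nat> \<union> {\<infinity>}\<close>, and it vanishes only on products of invertible generators.
  A homomorphism that agrees with \<open>deg det\<close> on diagonal matrices is determined by its values
  on elementary matrices, and these are forced to be \<open>0\<close>.
\<close>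

subsection \<open>Matrices over a ring\<close>

text \<open>Elimination leaves a pivot in every column, so the position \<open>i\<close> is free,
  whereas the Dieudonne determinant is prescribed only for an entry in the last place.\<close>

definition dilation_matrix :: "nat \<Rightarrow> 's ring \<Rightarrow> nat \<Rightarrow> 's \<Rightarrow> 's mat" where
  "dilation_matrix n S i d =
     mat n n (\<lambda>(k, l). if k \<noteq> l then \<zero>\<^bsub>S\<^esub> else if k = i then d else \<one>\<^bsub>S\<^esub>)"

lemma last_diag_matrix_eq_dilation: "last_diag_matrix n S q = dilation_matrix n S (n - 1) q"
  unfolding last_diag_matrix_def dilation_matrix_def ..

lemma matrix_ring_carrier_iff:
  "A \<in> carrier (matrix_ring n S) \<longleftrightarrow>
     A \<in> carrier_mat n n \<and> (\<forall>i<n. \<forall>j<n. A $$ (i, j) \<in> carrier S)"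
  by (simp add: matrix_ring_def)

lemma matrix_ring_dim:
  assumes "A \<in> carrier (matrix_ring n S)"
  shows "dim_row A = n" "dim_col A = n"
  using assms by (auto simp: matrix_ring_def)

lemma matrix_ring_index_closed:
  "A \<in> carrier (matrix_ring n S) \<Longrightarrow> i < n \<Longrightarrow> j < n \<Longrightarrow> A $$ (i, j) \<in> carrier S"
  by (simp add: matrix_ring_def)

lemma matrix_ring_eqI:
  assumes "A \<in> carrier (matrix_ring n S)" "B \<in> carrier (matrix_ring n S)"
    and "\<And>i j. i < n \<Longrightarrow> j < n \<Longrightarrow> A $$ (i, j) = B $$ (i, j)"
  shows "A = B"
  using assms by (intro eq_matI) (auto simp: matrix_ring_dim)

lemma index_matrix_ring_mult:
  "i < n \<Longrightarrow> j < n \<Longrightarrow>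
     (A \<otimes>\<^bsub>matrix_ring n S\<^esub> B) $$ (i, j) = (\<Oplus>\<^bsub>S\<^esub>k\<in>{..<n}. A $$ (i, k) \<otimes>\<^bsub>S\<^esub> B $$ (k, j))"
  by (simp add: matrix_ring_def)

lemma index_matrix_ring_one:
  "i < n \<Longrightarrow> j < n \<Longrightarrow> \<one>\<^bsub>matrix_ring n S\<^esub> $$ (i, j) = (if i = j then \<one>\<^bsub>S\<^esub> else \<zero>\<^bsub>S\<^esub>)"
  by (simp add: matrix_ring_def)

lemma index_elementary_matrix:
  "k < n \<Longrightarrow> l < n \<Longrightarrow> elementary_matrix n S i j c $$ (k, l) =
     (if k = l then \<one>\<^bsub>S\<^esub> else if k = i \<and> l = j then c else \<zero>\<^bsub>S\<^esub>)"
  by (simp add: elementary_matrix_def)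

lemma index_dilation_matrix:
  "k < n \<Longrightarrow> l < n \<Longrightarrow> dilation_matrix n S i d $$ (k, l) =
     (if k \<noteq> l then \<zero>\<^bsub>S\<^esub> else if k = i then d else \<one>\<^bsub>S\<^esub>)"
  by (simp add: dilation_matrix_def)

text \<open>Interpreted both for the skew polynomial ring and for its skew field of fractions. The
  ring is not commutative: row operations multiply from the left, column operations from the
  right.\<close>

locale matrix_base_ring = ring R for R :: "'a ring" (structure)
begin

section \<open>The multiplicative monoid of square matrices\<close>

lemma matrix_ring_mult_closed:
  "A \<in> carrier (matrix_ring n R) \<Longrightarrow> B \<in> carrier (matrix_ring n R) \<Longrightarrow>
     A \<otimes>\<^bsub>matrix_ring n R\<^esub> B \<in> carrier (matrix_ring n R)"
  by (auto simp: matrix_ring_def intro!: finsum_closed)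

lemma matrix_ring_one_closed: "\<one>\<^bsub>matrix_ring n R\<^esub> \<in> carrier (matrix_ring n R)"
  by (auto simp: matrix_ring_def)

lemma elementary_matrix_closed:
  "c \<in> carrier R \<Longrightarrow> elementary_matrix n R i j c \<in> carrier (matrix_ring n R)"
  by (auto simp: matrix_ring_def elementary_matrix_def)

lemma dilation_matrix_closed:
  "d \<in> carrier R \<Longrightarrow> dilation_matrix n R i d \<in> carrier (matrix_ring n R)"
  by (auto simp: matrix_ring_def dilation_matrix_def)

text \<open>Evaluates the entries of products with dilation and elementary matrices, whose sums have
  at most one or two non-zero terms.\<close>

lemma finsum_single:
  assumes "i \<in> A" "finite A" "f i \<in> carrier R" "\<And>k. k \<in> A \<Longrightarrow> k \<noteq> i \<Longrightarrow> f k = \<zero>"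
  shows "finsum R f A = f i"
proof -
  have "finsum R f A = (\<Oplus>j\<in>A. if i = j then f j else \<zero>)"
    using assms by (intro finsum_cong') (auto intro: assms(4)[symmetric])
  also have "\<dots> = (\<Oplus>j\<in>A. if i = j then f i else \<zero>)"
    using assms by (intro finsum_cong') auto
  also have "\<dots> = f i"
    using assms finsum_singleton[of i A "\<lambda>_. f i"] by auto
  finally show ?thesis .
qed

lemma finsum_finsum_swap:
  assumes "finite A" "finite B" "\<And>a b. a \<in> A \<Longrightarrow> b \<in> B \<Longrightarrow> g a b \<in> carrier R"
  shows "(\<Oplus>a\<in>A. \<Oplus>b\<in>B. g a b) = (\<Oplus>b\<in>B. \<Oplus>a\<in>A. g a b)"
  using assms(1,3)
proof (induction A rule: finite_induct)
  case empty
  then show ?case by (simp add: finsum_zero)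
next
  case (insert x F)
  then have "(\<Oplus>a\<in>insert x F. \<Oplus>b\<in>B. g a b) = (\<Oplus>b\<in>B. g x b) \<oplus> (\<Oplus>b\<in>B. \<Oplus>a\<in>F. g a b)"
    by (subst finsum_insert) (auto intro!: finsum_closed)
  also have "\<dots> = (\<Oplus>b\<in>B. g x b \<oplus> (\<Oplus>a\<in>F. g a b))"
    using insert by (intro finsum_addf[symmetric]) (auto intro!: finsum_closed)
  also have "\<dots> = (\<Oplus>b\<in>B. \<Oplus>a\<in>insert x F. g a b)"
    using insert by (intro finsum_cong') (auto intro!: finsum_closed)
  finally show ?case .
qed

lemma matrix_ring_mult_assoc:
  assumes "A \<in> carrier (matrix_ring n R)" "B \<in> carrier (matrix_ring n R)"
    "C \<in> carrier (matrix_ring n R)"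
  shows "(A \<otimes>\<^bsub>matrix_ring n R\<^esub> B) \<otimes>\<^bsub>matrix_ring n R\<^esub> C =
    A \<otimes>\<^bsub>matrix_ring n R\<^esub> (B \<otimes>\<^bsub>matrix_ring n R\<^esub> C)"
proof (rule matrix_ring_eqI)
  fix i j assume ij: "i < n" "j < n"
  note [simp] = matrix_ring_index_closed[OF assms(1)] matrix_ring_index_closed[OF assms(2)]
    matrix_ring_index_closed[OF assms(3)]
  have "((A \<otimes>\<^bsub>matrix_ring n R\<^esub> B) \<otimes>\<^bsub>matrix_ring n R\<^esub> C) $$ (i, j) =
      (\<Oplus>k\<in>{..<n}. (\<Oplus>l\<in>{..<n}. A $$ (i, l) \<otimes> B $$ (l, k)) \<otimes> C $$ (k, j))"
    using ij by (auto simp: index_matrix_ring_mult intro!: finsum_cong' finsum_closed)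
  also have "\<dots> = (\<Oplus>k\<in>{..<n}. \<Oplus>l\<in>{..<n}. A $$ (i, l) \<otimes> B $$ (l, k) \<otimes> C $$ (k, j))"
    using ij by (intro finsum_cong' finsum_ldistr) (auto intro!: finsum_closed)
  also have "\<dots> = (\<Oplus>l\<in>{..<n}. \<Oplus>k\<in>{..<n}. A $$ (i, l) \<otimes> B $$ (l, k) \<otimes> C $$ (k, j))"
    using ij by (intro finsum_finsum_swap) auto
  also have "\<dots> = (\<Oplus>l\<in>{..<n}. \<Oplus>k\<in>{..<n}. A $$ (i, l) \<otimes> (B $$ (l, k) \<otimes> C $$ (k, j)))"
    using ij by (intro finsum_cong') (auto intro!: finsum_cong' finsum_closed simp: m_assoc)
  also have "\<dots> = (\<Oplus>l\<in>{..<n}. A $$ (i, l) \<otimes> (\<Oplus>k\<in>{..<n}. B $$ (l, k) \<otimes> C $$ (k, j)))"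
    using ij by (intro finsum_cong' finsum_rdistr[symmetric]) (auto intro!: finsum_closed)
  also have "\<dots> = (A \<otimes>\<^bsub>matrix_ring n R\<^esub> (B \<otimes>\<^bsub>matrix_ring n R\<^esub> C)) $$ (i, j)"
    using ij by (auto simp: index_matrix_ring_mult intro!: finsum_cong' finsum_closed)
  finally show "((A \<otimes>\<^bsub>matrix_ring n R\<^esub> B) \<otimes>\<^bsub>matrix_ring n R\<^esub> C) $$ (i, j) = \<dots>" .
qed (use assms in \<open>auto intro!: matrix_ring_mult_closed\<close>)

lemma index_dilation_mult:
  assumes "A \<in> carrier (matrix_ring n R)" "d \<in> carrier R" "k < n" "l < n"
  shows "(dilation_matrix n R i d \<otimes>\<^bsub>matrix_ring n R\<^esub> A) $$ (k, l) =
    (if k = i then d \<otimes> A $$ (k, l) else A $$ (k, l))"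
proof -
  note [simp] = matrix_ring_index_closed[OF assms(1)]
  have "(dilation_matrix n R i d \<otimes>\<^bsub>matrix_ring n R\<^esub> A) $$ (k, l) =
      (\<Oplus>m\<in>{..<n}. dilation_matrix n R i d $$ (k, m) \<otimes> A $$ (m, l))"
    using assms by (simp add: index_matrix_ring_mult)
  also have "\<dots> = dilation_matrix n R i d $$ (k, k) \<otimes> A $$ (k, l)"
    using assms by (intro finsum_single) (auto simp: index_dilation_matrix)
  finally show ?thesis using assms by (simp add: index_dilation_matrix)
qed

lemma index_mult_dilation:
  assumes "A \<in> carrier (matrix_ring n R)" "d \<in> carrier R" "k < n" "l < n"
  shows "(A \<otimes>\<^bsub>matrix_ring n R\<^esub> dilation_matrix n R i d) $$ (k, l) =
    (if l = i then A $$ (k, l) \<otimes> d else A $$ (k, l))"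
proof -
  note [simp] = matrix_ring_index_closed[OF assms(1)]
  have "(A \<otimes>\<^bsub>matrix_ring n R\<^esub> dilation_matrix n R i d) $$ (k, l) =
      (\<Oplus>m\<in>{..<n}. A $$ (k, m) \<otimes> dilation_matrix n R i d $$ (m, l))"
    using assms by (simp add: index_matrix_ring_mult)
  also have "\<dots> = A $$ (k, l) \<otimes> dilation_matrix n R i d $$ (l, l)"
    using assms by (intro finsum_single) (auto simp: index_dilation_matrix)
  finally show ?thesis using assms by (simp add: index_dilation_matrix)
qed

lemma dilation_matrix_one: "dilation_matrix n R i \<one> = \<one>\<^bsub>matrix_ring n R\<^esub>"
  by (auto simp: dilation_matrix_def matrix_ring_def)

lemma elementary_matrix_zero: "elementary_matrix n R i j \<zero> = \<one>\<^bsub>matrix_ring n R\<^esub>"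
  by (auto simp: elementary_matrix_def matrix_ring_def)

lemma matrix_ring_one_mult:
  assumes "A \<in> carrier (matrix_ring n R)"
  shows "\<one>\<^bsub>matrix_ring n R\<^esub> \<otimes>\<^bsub>matrix_ring n R\<^esub> A = A"
    and "A \<otimes>\<^bsub>matrix_ring n R\<^esub> \<one>\<^bsub>matrix_ring n R\<^esub> = A"
  \<comment> \<open>The identity is a dilation with entry 1, so the index rules for dilations give
    both products. The position 0 is arbitrary and harmless for \<open>n = 0\<close>.\<close>
  unfolding dilation_matrix_one[symmetric, of n 0]
  using assms matrix_ring_index_closed[OF assms]
  by (auto intro!: matrix_ring_eqI[where n = n and S = R] matrix_ring_mult_closed
      dilation_matrix_closed simp: index_dilation_mult index_mult_dilation)

lemma monoid_matrix_ring: "monoid (matrix_ring n R)"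
  by (rule monoidI)
    (auto simp: matrix_ring_mult_assoc matrix_ring_one_mult matrix_ring_mult_closed
      matrix_ring_one_closed)

section \<open>Elementary and dilation matrices as row and column operations\<close>

lemma index_elementary_mult:
  assumes "A \<in> carrier (matrix_ring n R)" "c \<in> carrier R" "i \<noteq> j" "j < n" "k < n" "l < n"
  shows "(elementary_matrix n R i j c \<otimes>\<^bsub>matrix_ring n R\<^esub> A) $$ (k, l) =
    (if k = i then A $$ (k, l) \<oplus> c \<otimes> A $$ (j, l) else A $$ (k, l))"
proof -
  note [simp] = matrix_ring_index_closed[OF assms(1)]
  \<comment> \<open>Since \<open>i\<close> and \<open>j\<close> differ, the entry \<open>c\<close>
    lies off the diagonal. Each summand therefore splits into a diagonal part, alive only at
    \<open>m = k\<close>, and a part with \<open>c\<close>, alive only at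
    \<open>m = j\<close>.\<close>
  have "(elementary_matrix n R i j c \<otimes>\<^bsub>matrix_ring n R\<^esub> A) $$ (k, l) =
      (\<Oplus>m\<in>{..<n}. (if m = k then A $$ (m, l) else \<zero>) \<oplus>
        (if m = j then if k = i then c \<otimes> A $$ (m, l) else \<zero> else \<zero>))"
    using assms
    unfolding index_matrix_ring_mult[OF assms(5,6)]
    by (intro finsum_cong') (auto simp: index_elementary_matrix)
  also have "\<dots> = (\<Oplus>m\<in>{..<n}. if m = k then A $$ (m, l) else \<zero>) \<oplus>
      (\<Oplus>m\<in>{..<n}. if m = j then if k = i then c \<otimes> A $$ (m, l) else \<zero> else \<zero>)"
    using assms by (intro finsum_addf) auto
  also have "(\<Oplus>m\<in>{..<n}. if m = k then A $$ (m, l) else \<zero>) = A $$ (k, l)"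
    using assms by (subst finsum_single[of k]) auto
  also have "(\<Oplus>m\<in>{..<n}. if m = j then if k = i then c \<otimes> A $$ (m, l) else \<zero> else \<zero>) =
      (if k = i then c \<otimes> A $$ (j, l) else \<zero>)"
    using assms by (subst finsum_single[of j]) auto
  finally show ?thesis using assms by simp
qed

lemma index_mult_elementary:
  assumes "A \<in> carrier (matrix_ring n R)" "c \<in> carrier R" "i \<noteq> j" "i < n" "k < n" "l < n"
  shows "(A \<otimes>\<^bsub>matrix_ring n R\<^esub> elementary_matrix n R i j c) $$ (k, l) =
    (if l = j then A $$ (k, l) \<oplus> A $$ (k, i) \<otimes> c else A $$ (k, l))"
proof -
  note [simp] = matrix_ring_index_closed[OF assms(1)]
  have "(A \<otimes>\<^bsub>matrix_ring n R\<^esub> elementary_matrix n R i j c) $$ (k, l) =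
      (\<Oplus>m\<in>{..<n}. (if m = l then A $$ (k, m) else \<zero>) \<oplus>
        (if m = i then if l = j then A $$ (k, m) \<otimes> c else \<zero> else \<zero>))"
    using assms
    unfolding index_matrix_ring_mult[OF assms(5,6)]
    by (intro finsum_cong') (auto simp: index_elementary_matrix)
  also have "\<dots> = (\<Oplus>m\<in>{..<n}. if m = l then A $$ (k, m) else \<zero>) \<oplus>
      (\<Oplus>m\<in>{..<n}. if m = i then if l = j then A $$ (k, m) \<otimes> c else \<zero> else \<zero>)"
    using assms by (intro finsum_addf) auto
  also have "(\<Oplus>m\<in>{..<n}. if m = l then A $$ (k, m) else \<zero>) = A $$ (k, l)"
    using assms by (subst finsum_single[of l]) auto
  also have "(\<Oplus>m\<in>{..<n}. if m = i then if l = j then A $$ (k, m) \<otimes> c else \<zero> else \<zero>) =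
      (if l = j then A $$ (k, i) \<otimes> c else \<zero>)"
    using assms by (subst finsum_single[of i]) auto
  finally show ?thesis using assms by simp
qed

text \<open>This additivity gives the inverses of elementary matrices and later turns a
  multiplicative map into an additive one in the entry.\<close>

lemma elementary_matrix_add:
  assumes "a \<in> carrier R" "b \<in> carrier R" "i \<noteq> j" "i < n" "j < n"
  shows "elementary_matrix n R i j a \<otimes>\<^bsub>matrix_ring n R\<^esub> elementary_matrix n R i j b =
    elementary_matrix n R i j (a \<oplus> b)"
  using assms
  by (intro matrix_ring_eqI[where n = n and S = R] matrix_ring_mult_closed elementary_matrix_closed)
    (auto simp: index_elementary_mult elementary_matrix_closed index_elementary_matrix a_ac)

lemma elementary_matrix_inverse:
  assumes "a \<in> carrier R" "i \<noteq> j" "i < n" "j < n"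
  shows "elementary_matrix n R i j (\<ominus> a) \<otimes>\<^bsub>matrix_ring n R\<^esub> elementary_matrix n R i j a =
      \<one>\<^bsub>matrix_ring n R\<^esub>"
    and "elementary_matrix n R i j a \<otimes>\<^bsub>matrix_ring n R\<^esub> elementary_matrix n R i j (\<ominus> a) =
      \<one>\<^bsub>matrix_ring n R\<^esub>"
  using assms by (simp_all add: elementary_matrix_add elementary_matrix_zero l_neg r_neg)

text \<open>Both products have \<open>d\<close> at \<open>(i, i)\<close> and \<open>d c\<close> at
  \<open>(i, j)\<close>. As \<open>d\<close> is any ring element, this replaces conjugation by a
  matrix that may fail to be invertible.\<close>

lemma dilation_elementary_commute:
  assumes "d \<in> carrier R" "c \<in> carrier R" "i \<noteq> j" "i < n" "j < n"
  shows "dilation_matrix n R i d \<otimes>\<^bsub>matrix_ring n R\<^esub> elementary_matrix n R i j c =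
    elementary_matrix n R i j (d \<otimes> c) \<otimes>\<^bsub>matrix_ring n R\<^esub> dilation_matrix n R i d"
  using assms
  by (intro matrix_ring_eqI[where n = n and S = R] matrix_ring_mult_closed elementary_matrix_closed
      dilation_matrix_closed)
    (auto simp: index_mult_dilation index_dilation_mult elementary_matrix_closed
      index_elementary_matrix)

lemma dilation_matrix_Units:
  assumes "d \<in> Units R"
  shows "dilation_matrix n R i d \<in> Units (matrix_ring n R)"
proof -
  from assms obtain e where e: "e \<in> carrier R" "d \<in> carrier R" "e \<otimes> d = \<one>" "d \<otimes> e = \<one>"
    unfolding Units_def by auto
  have *: "dilation_matrix n R i a \<otimes>\<^bsub>matrix_ring n R\<^esub> dilation_matrix n R i b =
      \<one>\<^bsub>matrix_ring n R\<^esub>" if "a \<otimes> b = \<one>" "a \<in> carrier R" "b \<in> carrier R" for a b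
    using that
    by (intro matrix_ring_eqI[where n = n and S = R] matrix_ring_mult_closed matrix_ring_one_closed
      dilation_matrix_closed)
    (auto simp: index_dilation_mult dilation_matrix_closed index_dilation_matrix
      index_matrix_ring_one)
  show ?thesis
    unfolding Units_def using e *[of d e] *[of e d] by (auto intro!: dilation_matrix_closed)
qed

lemma elementary_matrix_Units:
  assumes "c \<in> carrier R" "i \<noteq> j" "i < n" "j < n"
  shows "elementary_matrix n R i j c \<in> Units (matrix_ring n R)"
  unfolding Units_def
  using assms elementary_matrix_inverse[OF assms]
  by (auto intro!: elementary_matrix_closed bexI[of _ "elementary_matrix n R i j (\<ominus> c)"])

text \<open>The standard factorisation of the block with rows (0, 1) and (-1, 0). Thanks to the
  sign, the exchange of two coordinates is a product of elementary matrices alone.\<close>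

definition signed_swap_matrix :: "nat \<Rightarrow> nat \<Rightarrow> nat \<Rightarrow> 'a mat" where
  "signed_swap_matrix n i j =
     elementary_matrix n R i j \<one> \<otimes>\<^bsub>matrix_ring n R\<^esub>
       (elementary_matrix n R j i (\<ominus> \<one>) \<otimes>\<^bsub>matrix_ring n R\<^esub> elementary_matrix n R i j \<one>)"

lemma index_signed_swap_matrix:
  assumes "i \<noteq> j" "i < n" "j < n" "k < n" "l < n"
  shows "signed_swap_matrix n i j $$ (k, l) =
    (if k = i then if l = j then \<one> else \<zero>
     else if k = j then if l = i then \<ominus> \<one> else \<zero>
     else if k = l then \<one> else \<zero>)"
  unfolding signed_swap_matrix_def using assms
  by (auto simp: index_elementary_mult elementary_matrix_closed index_elementary_matrix
      matrix_ring_mult_closed l_neg r_neg r_neg1 l_minus)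

lemma signed_swap_matrix_closed: "signed_swap_matrix n i j \<in> carrier (matrix_ring n R)"
  unfolding signed_swap_matrix_def
  by (intro matrix_ring_mult_closed elementary_matrix_closed) auto

text \<open>Moves the entry \<open>d\<close> from place \<open>j\<close> to place \<open>i\<close>,
  so that a value known for the last place can be carried to all places.\<close>

lemma signed_swap_dilation_commute:
  assumes "d \<in> carrier R" "i \<noteq> j" "i < n" "j < n"
  shows "signed_swap_matrix n i j \<otimes>\<^bsub>matrix_ring n R\<^esub> dilation_matrix n R j d =
    dilation_matrix n R i d \<otimes>\<^bsub>matrix_ring n R\<^esub> signed_swap_matrix n i j"
  using assms
  by (intro matrix_ring_eqI[where n = n and S = R] matrix_ring_mult_closed signed_swap_matrix_closed
      dilation_matrix_closed)
    (auto simp: index_mult_dilation index_dilation_mult signed_swap_matrix_closed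
      index_signed_swap_matrix)

end

subsection \<open>Factorisation of matrices over a Euclidean ring\<close>

context matrix_base_ring
begin

text \<open>Closure under binary products, instead of lists of factors, lets statements about all
  matrices be proved by induction on generators and multiplicativity.\<close>

inductive_set elementary_dilation_products :: "nat \<Rightarrow> 'a mat set" for n where
  one: "\<one>\<^bsub>matrix_ring n R\<^esub> \<in> elementary_dilation_products n"
| elementary: "\<lbrakk>c \<in> carrier R; i \<noteq> j; i < n; j < n\<rbrakk> \<Longrightarrow>
    elementary_matrix n R i j c \<in> elementary_dilation_products n"
| dilation: "\<lbrakk>d \<in> carrier R; i < n\<rbrakk> \<Longrightarrow>
    dilation_matrix n R i d \<in> elementary_dilation_products n"
| mult: "\<lbrakk>A \<in> elementary_dilation_products n; B \<in> elementary_dilation_products n\<rbrakk> \<Longrightarrow>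
    A \<otimes>\<^bsub>matrix_ring n R\<^esub> B \<in> elementary_dilation_products n"

lemma elementary_dilation_products_closed:
  "A \<in> elementary_dilation_products n \<Longrightarrow> A \<in> carrier (matrix_ring n R)"
  by (induction rule: elementary_dilation_products.induct)
    (auto intro: matrix_ring_one_closed elementary_matrix_closed dilation_matrix_closed
      matrix_ring_mult_closed)

text \<open>The inverse of an elementary matrix is elementary, so a row operation can be undone
  inside the set; elimination may replace \<open>A\<close> by its transform.\<close>

lemma elementary_mult_in_productsD:
  assumes "elementary_matrix n R i j c \<otimes>\<^bsub>matrix_ring n R\<^esub> A \<in> elementary_dilation_products n"
    and "A \<in> carrier (matrix_ring n R)" "c \<in> carrier R" "i \<noteq> j" "i < n" "j < n"
  shows "A \<in> elementary_dilation_products n"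
proof -
  have "elementary_matrix n R i j (\<ominus> c) \<otimes>\<^bsub>matrix_ring n R\<^esub>
      (elementary_matrix n R i j c \<otimes>\<^bsub>matrix_ring n R\<^esub> A) = A"
    using assms
    by (simp add: matrix_ring_mult_assoc[symmetric] elementary_matrix_closed
        elementary_matrix_inverse matrix_ring_one_mult)
  then show ?thesis
    using assms elementary_dilation_products.mult[OF
        elementary_dilation_products.elementary[of "\<ominus> c" i j n] assms(1)]
    by auto
qed

lemma mult_elementary_in_productsD:
  assumes "A \<otimes>\<^bsub>matrix_ring n R\<^esub> elementary_matrix n R i j c \<in> elementary_dilation_products n"
    and "A \<in> carrier (matrix_ring n R)" "c \<in> carrier R" "i \<noteq> j" "i < n" "j < n"
  shows "A \<in> elementary_dilation_products n"
proof -
  have "A \<otimes>\<^bsub>matrix_ring n R\<^esub> elementary_matrix n R i j c \<otimes>\<^bsub>matrix_ring n R\<^esub>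
      elementary_matrix n R i j (\<ominus> c) = A"
    using assms
    by (simp add: matrix_ring_mult_assoc elementary_matrix_closed
        elementary_matrix_inverse matrix_ring_one_mult)
  then show ?thesis
    using assms elementary_dilation_products.mult[OF assms(1)
        elementary_dilation_products.elementary[of "\<ominus> c" i j n]]
    by auto
qed

text \<open>The state of elimination after \<open>m\<close> pivots. The size \<open>n\<close> stays
  fixed, which avoids passing to smaller blocks.\<close>

definition identity_border :: "nat \<Rightarrow> nat \<Rightarrow> 'a mat \<Rightarrow> bool" where
  "identity_border n m A \<longleftrightarrow>
     (\<forall>i<n. \<forall>j<n. i < m \<or> j < m \<longrightarrow> A $$ (i, j) = (if i = j then \<one> else \<zero>))"

lemma identity_border_full:
  assumes "A \<in> carrier (matrix_ring n R)" "identity_border n n A"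
  shows "A = \<one>\<^bsub>matrix_ring n R\<^esub>"
  using assms
  by (intro matrix_ring_eqI[where n = n and S = R] matrix_ring_one_closed)
    (auto simp: identity_border_def index_matrix_ring_one)

text \<open>Row \<open>j\<close> vanishes in the first \<open>m\<close> columns because
  \<open>m\<close> is at most \<open>j\<close>, and the first \<open>m\<close> rows are not
  modified.\<close>

lemma identity_border_elementary_mult:
  assumes "A \<in> carrier (matrix_ring n R)" "identity_border n m A"
    and "c \<in> carrier R" "i \<noteq> j" "m \<le> i" "i < n" "m \<le> j" "j < n"
  shows "identity_border n m (elementary_matrix n R i j c \<otimes>\<^bsub>matrix_ring n R\<^esub> A)"
  using assms by (auto simp: identity_border_def index_elementary_mult)

text \<open>Column \<open>m\<close> is a unit vector, so adding a right multiple of it to column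
  \<open>l\<close> changes only the entry \<open>(m, l)\<close>, which can thus be made zero. The
  induction counts the non-zero entries of row \<open>m\<close> to the right of the pivot.\<close>

lemma identity_column_in_products:
  assumes IH: "\<And>A. A \<in> carrier (matrix_ring n R) \<Longrightarrow> identity_border n (Suc m) A \<Longrightarrow>
      A \<in> elementary_dilation_products n"
    and "m < n" "A \<in> carrier (matrix_ring n R)" "identity_border n m A"
    and "\<And>i. i < n \<Longrightarrow> A $$ (i, m) = (if i = m then \<one> else \<zero>)"
  shows "A \<in> elementary_dilation_products n"
  using assms(3-)
proof (induction "card {l. m < l \<and> l < n \<and> A $$ (m, l) \<noteq> \<zero>}" arbitrary: A)
  case 0
  then have "\<forall>l. m < l \<and> l < n \<longrightarrow> A $$ (m, l) = \<zero>" by auto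
  with 0(3,4) have "identity_border n (Suc m) A"
    by (auto simp: identity_border_def less_Suc_eq) (metis linorder_neqE_nat)
  with 0 show ?case by (intro IH)
next
  case (Suc N)
  let ?S = "{l. m < l \<and> l < n \<and> A $$ (m, l) \<noteq> \<zero>}"
  from Suc(2) have "?S \<noteq> {}" by (metis card.empty nat.distinct(1))
  then obtain l where l: "m < l" "l < n" "A $$ (m, l) \<noteq> \<zero>" by blast
  let ?E = "elementary_matrix n R m l (\<ominus> A $$ (m, l))"
  let ?B = "A \<otimes>\<^bsub>matrix_ring n R\<^esub> ?E"
  note A = Suc(3-5) and [simp] = matrix_ring_index_closed[OF Suc(3)]
  have idx: "?B $$ (k, j) = (if j = l then if k = m then \<zero> else A $$ (k, j) else A $$ (k, j))"
    if "k < n" "j < n" for k j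
    using that l A assms(2) by (auto simp: index_mult_elementary r_neg)
  have "{j. m < j \<and> j < n \<and> ?B $$ (m, j) \<noteq> \<zero>} = ?S - {l}"
    using l assms(2) by (auto simp: idx split: if_splits)
  then have "N = card {j. m < j \<and> j < n \<and> ?B $$ (m, j) \<noteq> \<zero>}"
    using Suc(2) l by (simp add: card_Diff_singleton)
  moreover have B: "?B \<in> carrier (matrix_ring n R)"
    using A l assms(2) by (intro matrix_ring_mult_closed elementary_matrix_closed) auto
  moreover have "identity_border n m ?B"
    using A(2) l by (auto simp: identity_border_def idx)
  moreover have "?B $$ (i, m) = (if i = m then \<one> else \<zero>)" if "i < n" for i
    using that A(3) l assms(2) by (simp add: idx)
  ultimately have "?B \<in> elementary_dilation_products n"
    by (rule Suc(1))
  then show ?case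
    using A l assms(2) by (intro mult_elementary_in_productsD[where A = A and i = m and j = l]) auto
qed

text \<open>Multiplying by a dilation on the right scales column \<open>m\<close> only. So the
  pivot, possibly zero, splits off without any division in the rest of row \<open>m\<close>, and the
  remaining factor \<open>B\<close> has pivot 1.\<close>

lemma cleared_column_in_products:
  assumes IH: "\<And>A. A \<in> carrier (matrix_ring n R) \<Longrightarrow> identity_border n (Suc m) A \<Longrightarrow>
      A \<in> elementary_dilation_products n"
    and m: "m < n" and A: "A \<in> carrier (matrix_ring n R)" "identity_border n m A"
    and col: "\<And>i. i < n \<Longrightarrow> i \<noteq> m \<Longrightarrow> A $$ (i, m) = \<zero>"
  shows "A \<in> elementary_dilation_products n"
proof -
  define B where "B = mat n n (\<lambda>(i, j). if j = m then if i = m then \<one> else \<zero> else A $$ (i, j))"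
  have idx: "B $$ (i, j) = (if j = m then if i = m then \<one> else \<zero> else A $$ (i, j))"
    if "i < n" "j < n" for i j
    using that by (simp add: B_def)
  note [simp] = matrix_ring_index_closed[OF A(1)]
  have B: "B \<in> carrier (matrix_ring n R)"
    unfolding matrix_ring_carrier_iff using A by (auto simp: B_def)
  moreover have "identity_border n m B"
    using A(2) by (auto simp: identity_border_def idx)
  ultimately have "B \<in> elementary_dilation_products n"
    using m by (intro identity_column_in_products[OF IH]) (auto simp: idx)
  then have "B \<otimes>\<^bsub>matrix_ring n R\<^esub> dilation_matrix n R m (A $$ (m, m)) \<in>
      elementary_dilation_products n"
    using m A by (intro elementary_dilation_products.mult elementary_dilation_products.dilation) auto
  also have "B \<otimes>\<^bsub>matrix_ring n R\<^esub> dilation_matrix n R m (A $$ (m, m)) = A"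
    using m A B col
    by (intro matrix_ring_eqI[where n = n and S = R] matrix_ring_mult_closed
        dilation_matrix_closed) (auto simp: index_mult_dilation idx)
  finally show ?thesis .
qed

text \<open>The Euclidean algorithm on the entries of column \<open>m\<close> from row
  \<open>m\<close> on, by induction on the sum of their sizes.\<close>

lemma bordered_matrix_in_products:
  fixes \<mu> :: "'a \<Rightarrow> nat"
  assumes euclid: "\<And>a b. a \<in> carrier R \<Longrightarrow> b \<in> carrier R \<Longrightarrow> b \<noteq> \<zero> \<Longrightarrow>
      \<exists>q\<in>carrier R. \<mu> (a \<oplus> q \<otimes> b) < \<mu> b"
    and IH: "\<And>A. A \<in> carrier (matrix_ring n R) \<Longrightarrow> identity_border n (Suc m) A \<Longrightarrow>
      A \<in> elementary_dilation_products n"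
    and m: "m < n" and "A \<in> carrier (matrix_ring n R)" "identity_border n m A"
  shows "A \<in> elementary_dilation_products n"
  using assms(4-)
proof (induction "\<Sum>i\<in>{m..<n}. \<mu> (A $$ (i, m))" arbitrary: A rule: less_induct)
  case less
  note A = less(2,3) and [simp] = matrix_ring_index_closed[OF less(2)]
  have above: "A $$ (i, m) = \<zero>" if "i < m" for i
    using that A(2) m by (auto simp: identity_border_def)
  \<comment> \<open>Dividing the entry in row \<open>i\<close> by the one in row \<open>j\<close>,
    which is no larger, leaves a strictly smaller entry in row \<open>i\<close>, so the sum of sizes
    drops. The quotient stands on the left, as a row operation requires.\<close>
  have row_op: "A \<in> elementary_dilation_products n"
    if ij: "i \<noteq> j" "m \<le> i" "i < n" "m \<le> j" "j < n" "A $$ (j, m) \<noteq> \<zero>"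
      and le: "\<mu> (A $$ (j, m)) \<le> \<mu> (A $$ (i, m))" for i j
  proof -
    from euclid[of "A $$ (i, m)" "A $$ (j, m)"] ij m
    obtain q where q: "q \<in> carrier R"
      "\<mu> (A $$ (i, m) \<oplus> q \<otimes> A $$ (j, m)) < \<mu> (A $$ (j, m))" by auto
    let ?B = "elementary_matrix n R i j q \<otimes>\<^bsub>matrix_ring n R\<^esub> A"
    have "(\<Sum>k\<in>{m..<n}. \<mu> (?B $$ (k, m))) < (\<Sum>k\<in>{m..<n}. \<mu> (A $$ (k, m)))"
    proof (rule sum_strict_mono_ex1)
      show "\<forall>k\<in>{m..<n}. \<mu> (?B $$ (k, m)) \<le> \<mu> (A $$ (k, m))"
        using A ij m q le by (auto simp: index_elementary_mult)
      show "\<exists>k\<in>{m..<n}. \<mu> (?B $$ (k, m)) < \<mu> (A $$ (k, m))"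
        using A ij m q le by (intro bexI[of _ i]) (auto simp: index_elementary_mult)
    qed simp
    then have "?B \<in> elementary_dilation_products n"
      using A ij q
      by (intro less(1) identity_border_elementary_mult matrix_ring_mult_closed
          elementary_matrix_closed) auto
    then show ?thesis using A ij q by (intro elementary_mult_in_productsD[where A = A and i = i and j = j]) auto
  qed
  \<comment> \<open>From row \<open>m\<close> on, column \<open>m\<close> has two non-zero entries,
    or none below the pivot, or exactly one, which lies below a zero pivot.\<close>
  consider i j where "i \<noteq> j" "m \<le> i" "i < n" "m \<le> j" "j < n" "A $$ (i, m) \<noteq> \<zero>" "A $$ (j, m) \<noteq> \<zero>"
    | "\<forall>i. m < i \<and> i < n \<longrightarrow> A $$ (i, m) = \<zero>"
    | i where "m < i" "i < n" "A $$ (i, m) \<noteq> \<zero>" "\<forall>j. m \<le> j \<and> j < n \<and> j \<noteq> i \<longrightarrow> A $$ (j, m) = \<zero>"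
    by (metis less_imp_le_nat)
  then show ?case
  proof cases
    case 1
    then show ?thesis using row_op[of i j] row_op[of j i] by (metis nat_le_linear)
  next
    case 2
    then show ?thesis
      using A m above by (intro cleared_column_in_products[OF IH]) (auto simp: not_less nat_neq_iff)
  next
    case 3
    \<comment> \<open>Adding row \<open>i\<close> to row \<open>m\<close> and subtracting the new
      row \<open>m\<close> from row \<open>i\<close> moves the only non-zero entry to the pivot. The
      sum of sizes is unchanged, so the cleared-column case is used instead of the induction
      hypothesis.\<close>
    let ?B = "elementary_matrix n R m i \<one> \<otimes>\<^bsub>matrix_ring n R\<^esub> A"
    let ?C = "elementary_matrix n R i m (\<ominus> \<one>) \<otimes>\<^bsub>matrix_ring n R\<^esub> ?B"
    have B: "?B \<in> carrier (matrix_ring n R)" "identity_border n m ?B"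
      using A 3 m by (auto intro!: matrix_ring_mult_closed elementary_matrix_closed
          identity_border_elementary_mult)
    have C: "?C \<in> carrier (matrix_ring n R)" "identity_border n m ?C"
      using B 3 m by (auto intro!: matrix_ring_mult_closed elementary_matrix_closed
          identity_border_elementary_mult)
    have "?C $$ (k, m) = \<zero>" if "k < n" "k \<noteq> m" for k
      using A B 3 m that above[of k]
      by (cases "k < m") (auto simp: index_elementary_mult l_minus r_neg not_less)
    then have "?C \<in> elementary_dilation_products n"
      using C m by (intro cleared_column_in_products[OF IH]) auto
    then have "?B \<in> elementary_dilation_products n"
      using B 3 m by (intro elementary_mult_in_productsD[where A = ?B and i = i and j = m]) auto
    then show ?thesis
      using A 3 m by (intro elementary_mult_in_productsD[where A = A and i = m and j = i]) auto
  qed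
qed

theorem euclidean_matrix_in_products:
  fixes \<mu> :: "'a \<Rightarrow> nat"
  assumes euclid: "\<And>a b. a \<in> carrier R \<Longrightarrow> b \<in> carrier R \<Longrightarrow> b \<noteq> \<zero> \<Longrightarrow>
      \<exists>q\<in>carrier R. \<mu> (a \<oplus> q \<otimes> b) < \<mu> b"
    and "A \<in> carrier (matrix_ring n R)"
  shows "A \<in> elementary_dilation_products n"
proof -
  \<comment> \<open>Descending induction: at \<open>m = n\<close> the border is the whole matrix, at
    \<open>m = 0\<close> it imposes no condition.\<close>
  have "\<forall>A. A \<in> carrier (matrix_ring n R) \<longrightarrow> identity_border n m A \<longrightarrow>
      A \<in> elementary_dilation_products n" if "m \<le> n" for m
    using that
  proof (induction rule: inc_induct)
    case base
    then show ?case
      using identity_border_full elementary_dilation_products.one by metis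
  next
    case (step m)
    then show ?case using bordered_matrix_in_products[OF euclid] by blast
  qed
  from this[of 0] assms(2) show ?thesis by (auto simp: identity_border_def)
qed

end

subsection \<open>Degrees of skew polynomials and of fractions\<close>

locale skew_polynomials = field_hom \<alpha> for \<alpha> :: "'k::field \<Rightarrow> 'k" +
  fixes \<delta> :: "'k \<Rightarrow> 'k"
  assumes alpha_derivation: "alpha_derivation \<alpha> \<delta>"
begin

abbreviation P :: "'k poly ring" where
  "P \<equiv> skew_poly_ring \<alpha> \<delta>"

lemma P_simps [simp]:
  "carrier P = UNIV" "monoid.mult P = skew_mult \<alpha> \<delta>" "one P = 1" "zero P = 0" "add P = (+)"
  by (simp_all add: skew_poly_ring_def)

sublocale P: matrix_base_ring P
  by (intro matrix_base_ring.intro skew_poly_ring_is_ring field_hom_axioms alpha_derivation)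

lemma derivation_0 [simp]: "\<delta> 0 = 0"
  using alpha_derivation unfolding alpha_derivation_def by (metis add_0 add_cancel_right_right)

section \<open>Degrees of products of skew polynomials\<close>

lemma coeff_skew_X_mult:
  "coeff (skew_X_mult \<alpha> \<delta> q) j =
     (case j of 0 \<Rightarrow> 0 | Suc i \<Rightarrow> \<alpha> (coeff q i)) + \<delta> (coeff q j)"
  by (simp add: skew_X_mult_def coeff_map_poly coeff_pCons split: nat.split)

text \<open>The new leading coefficient is the image of the old one under \<alpha>, which is
  injective as an endomorphism of a field; \<delta> does not raise the degree.\<close>

lemma degree_skew_X_mult:
  assumes "q \<noteq> 0"
  shows "degree (skew_X_mult \<alpha> \<delta> q) = Suc (degree q)" "skew_X_mult \<alpha> \<delta> q \<noteq> 0"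
proof -
  have lead: "coeff (skew_X_mult \<alpha> \<delta> q) (Suc (degree q)) \<noteq> 0"
    using assms by (simp add: coeff_skew_X_mult coeff_eq_0)
  have "coeff (skew_X_mult \<alpha> \<delta> q) j = 0" if "j > Suc (degree q)" for j
    using that by (auto simp: coeff_skew_X_mult coeff_eq_0 split: nat.split)
  then have "degree (skew_X_mult \<alpha> \<delta> q) \<le> Suc (degree q)" by (intro degree_le) auto
  with lead show "degree (skew_X_mult \<alpha> \<delta> q) = Suc (degree q)" "skew_X_mult \<alpha> \<delta> q \<noteq> 0"
    using le_degree[OF lead] by auto
qed

lemma degree_skew_X_mult_funpow:
  assumes "q \<noteq> 0"
  shows "degree ((skew_X_mult \<alpha> \<delta> ^^ i) q) = i + degree q \<and> (skew_X_mult \<alpha> \<delta> ^^ i) q \<noteq> 0"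
  by (induction i) (use assms in \<open>auto simp: degree_skew_X_mult\<close>)

lemma skew_mult_monom: "skew_mult \<alpha> \<delta> (monom c i) q = Polynomial.smult c ((skew_X_mult \<alpha> \<delta> ^^ i) q)"
proof (cases "c = 0")
  case False
  have "(\<Sum>j\<le>i. Polynomial.smult (coeff (monom c i) j) ((skew_X_mult \<alpha> \<delta> ^^ j) q)) =
      (\<Sum>j\<le>i. if j = i then Polynomial.smult c ((skew_X_mult \<alpha> \<delta> ^^ i) q) else 0)"
    by (intro sum.cong) auto
  with False show ?thesis by (simp add: skew_mult_def degree_monom_eq)
qed (simp add: skew_mult_def)

text \<open>The summand for \<open>i\<close> has degree at most \<open>i + degree q\<close>, so only
  \<open>i = degree p\<close> reaches the top, with a product of two non-zero field elements as
  coefficient.\<close>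

lemma skew_mult_nonzero:
  assumes "p \<noteq> 0" "q \<noteq> 0"
  shows "degree (skew_mult \<alpha> \<delta> p q) = degree p + degree q" "skew_mult \<alpha> \<delta> p q \<noteq> 0"
proof -
  let ?T = "\<lambda>i. (skew_X_mult \<alpha> \<delta> ^^ i) q"
  note deg_T = degree_skew_X_mult_funpow[OF assms(2)]
  have "coeff (skew_mult \<alpha> \<delta> p q) (degree p + degree q) =
      (\<Sum>i\<le>degree p. coeff p i * coeff (?T i) (degree p + degree q))"
    by (simp add: skew_mult_def coeff_sum)
  also have "\<dots> = (\<Sum>i\<le>degree p. if i = degree p then lead_coeff p * lead_coeff (?T i) else 0)"
    by (intro sum.cong) (auto simp: deg_T coeff_eq_0)
  also have "\<dots> = lead_coeff p * lead_coeff (?T (degree p))" by simp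
  also have "\<dots> \<noteq> 0" using assms(1) deg_T[of "degree p"] by (metis leading_coeff_0_iff mult_eq_0_iff)
  finally have lead: "coeff (skew_mult \<alpha> \<delta> p q) (degree p + degree q) \<noteq> 0" .
  have "degree (skew_mult \<alpha> \<delta> p q) \<le> degree p + degree q"
    unfolding skew_mult_def
    by (intro degree_sum_le) (auto intro!: order.trans[OF degree_smult_le] simp: deg_T)
  with le_degree[OF lead] show "degree (skew_mult \<alpha> \<delta> p q) = degree p + degree q" by simp
  from lead show "skew_mult \<alpha> \<delta> p q \<noteq> 0" by auto
qed

text \<open>The shift by one puts 0 strictly below the non-zero constants, so that dividing by a
  constant leaves remainder 0.\<close>

definition euclid_size :: "'k poly \<Rightarrow> nat" where
  "euclid_size p = (if p = 0 then 0 else Suc (degree p))"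

text \<open>A monomial multiple of \<open>b\<close> cancels the leading term of \<open>a\<close>.
  The quotient stands to the left of \<open>b\<close>, so its coefficients come from division in the
  field and no preimage under \<alpha> is needed.\<close>

lemma skew_division:
  assumes "b \<noteq> 0"
  shows "\<exists>q. euclid_size (a + skew_mult \<alpha> \<delta> q b) < euclid_size b"
proof (induction "euclid_size a" arbitrary: a rule: less_induct)
  case less
  show ?case
  proof (cases "euclid_size a < euclid_size b")
    case True
    then show ?thesis by (intro exI[of _ 0]) (simp add: skew_mult_def)
  next
    case False
    then have a: "a \<noteq> 0" "degree b \<le> degree a"
      using assms by (auto simp: euclid_size_def split: if_splits)
    define e where "e = degree a - degree b"
    define t where "t = (skew_X_mult \<alpha> \<delta> ^^ e) b"
    define m where "m = monom (- lead_coeff a / lead_coeff t) e"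
    have t: "degree t = degree a" "t \<noteq> 0"
      using degree_skew_X_mult_funpow[OF assms, of e] a by (auto simp: t_def e_def)
    let ?a' = "a + skew_mult \<alpha> \<delta> m b"
    have a': "?a' = a + Polynomial.smult (- lead_coeff a / lead_coeff t) t"
      by (simp add: m_def skew_mult_monom t_def)
    have "degree ?a' \<le> degree a"
      unfolding a' by (intro degree_add_le) (auto intro!: order.trans[OF degree_smult_le] simp: t)
    moreover have "coeff ?a' (degree a) = 0"
      using t unfolding a' by simp (metis leading_coeff_0_iff nonzero_eq_divide_eq)
    ultimately have "euclid_size ?a' < euclid_size a"
      using a by (metis euclid_size_def leading_coeff_0_iff le_neq_implies_less not_less_eq
          zero_less_Suc)
    from less[OF this] obtain q where "euclid_size (?a' + skew_mult \<alpha> \<delta> q b) < euclid_size b" ..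
    moreover have "skew_mult \<alpha> \<delta> (m + q) b = skew_mult \<alpha> \<delta> m b + skew_mult \<alpha> \<delta> q b"
      using P.l_distr[of m q b] by simp
    ultimately show ?thesis by (intro exI[of _ "m + q"]) (simp add: add.assoc)
  qed
qed

lemma matrix_in_elementary_dilation_products:
  "A \<in> carrier (matrix_ring n P) \<Longrightarrow> A \<in> P.elementary_dilation_products n"
  by (rule P.euclidean_matrix_in_products[where \<mu> = euclid_size]) (use skew_division in auto)

lemma degree_0_Units:
  assumes "p \<noteq> 0" "degree p = 0"
  shows "p \<in> Units P"
proof -
  from assms(2) obtain c where c: "p = [:c:]" by (rule degree_eq_zeroE)
  with assms have "skew_mult \<alpha> \<delta> p [:inverse c:] = 1" "skew_mult \<alpha> \<delta> [:inverse c:] p = 1"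
    by (simp_all add: skew_mult_def)
  then show ?thesis by (auto simp: Units_def)
qed

end

section \<open>The Ore condition and the degree of fractions\<close>

locale skew_fractions = skew_polynomials \<alpha> \<delta> for \<alpha> \<delta> :: "'k::field \<Rightarrow> 'k" +
  fixes Q :: "'q ring" and \<iota> :: "'k poly \<Rightarrow> 'q"
  assumes fractions: "is_skew_field_of_fractions P Q \<iota>"
begin

sublocale Q: matrix_base_ring Q
  using fractions
  by (auto simp: matrix_base_ring_def is_skew_field_of_fractions_def is_skew_field_def)

lemma Units_Q: "Units Q = carrier Q - {\<zero>\<^bsub>Q\<^esub>}"
  using fractions by (auto simp: is_skew_field_of_fractions_def is_skew_field_def)

lemma one_neq_zero_Q: "\<one>\<^bsub>Q\<^esub> \<noteq> \<zero>\<^bsub>Q\<^esub>"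
  using Q.Units_one_closed Units_Q by auto

lemma embed_hom: "\<iota> \<in> Ring.ring_hom P Q"
  using fractions by (simp add: is_skew_field_of_fractions_def)

lemma embed_closed [simp]: "\<iota> p \<in> carrier Q"
  using ring_hom_closed[OF embed_hom] by simp

lemma embed_mult: "\<iota> (skew_mult \<alpha> \<delta> p q) = \<iota> p \<otimes>\<^bsub>Q\<^esub> \<iota> q"
  using ring_hom_mult[OF embed_hom] by simp

lemma embed_add: "\<iota> (p + q) = \<iota> p \<oplus>\<^bsub>Q\<^esub> \<iota> q"
  using ring_hom_add[OF embed_hom] by simp

lemma embed_1 [simp]: "\<iota> 1 = \<one>\<^bsub>Q\<^esub>"
  using ring_hom_one[OF embed_hom] by simp

lemma embed_0 [simp]: "\<iota> 0 = \<zero>\<^bsub>Q\<^esub>"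
  using ring_hom_zero[OF embed_hom P.ring_axioms Q.ring_axioms] by simp

lemma embed_eq_iff [simp]: "\<iota> p = \<iota> q \<longleftrightarrow> p = q"
  using fractions by (auto simp: is_skew_field_of_fractions_def inj_on_def)

lemma embed_Units: "p \<noteq> 0 \<Longrightarrow> \<iota> p \<in> Units Q"
  using embed_eq_iff[of p 0] by (auto simp: Units_Q)

lemma fraction_cases:
  assumes "x \<in> carrier Q"
  obtains r s where "x = fraction Q \<iota> r s" "s \<noteq> 0"
  using assms fractions by (auto simp: is_skew_field_of_fractions_def)

lemma fraction_closed: "s \<noteq> 0 \<Longrightarrow> fraction Q \<iota> r s \<in> carrier Q"
  using embed_Units[of s] by (simp add: fraction_def)

lemma fraction_mult_denominator:
  "s \<noteq> 0 \<Longrightarrow> \<iota> s \<otimes>\<^bsub>Q\<^esub> fraction Q \<iota> r s = \<iota> r"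
  using embed_Units[of s] by (simp add: fraction_def Q.m_assoc[symmetric])

lemma eq_fractionI:
  assumes "x \<in> carrier Q" "s \<noteq> 0" "\<iota> s \<otimes>\<^bsub>Q\<^esub> x = \<iota> r"
  shows "x = fraction Q \<iota> r s"
  using assms embed_Units[of s] by (simp add: fraction_def assms(3)[symmetric] Q.m_assoc[symmetric])

lemma fraction_zero_iff:
  assumes "s \<noteq> 0"
  shows "fraction Q \<iota> r s = \<zero>\<^bsub>Q\<^esub> \<longleftrightarrow> r = 0"
  using fraction_mult_denominator[OF assms, of r] eq_fractionI[OF Q.zero_closed assms, of r]
    embed_eq_iff[of r 0] by auto

text \<open>The Ore condition is read off from \<open>Q\<close>: the element \<open>a / b\<close>
  with the inverse on the right is also a left fraction with denominator \<open>v\<close> and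
  numerator \<open>u\<close>; clear both denominators and use that \<open>\<iota>\<close> is
  injective.\<close>

lemma left_ore:
  assumes "b \<noteq> 0"
  obtains u v where "v \<noteq> 0" "skew_mult \<alpha> \<delta> v a = skew_mult \<alpha> \<delta> u b"
proof -
  note b = embed_Units[OF assms]
  have "\<iota> a \<otimes>\<^bsub>Q\<^esub> inv\<^bsub>Q\<^esub> \<iota> b \<in> carrier Q" using b by auto
  then obtain u v where uv: "\<iota> a \<otimes>\<^bsub>Q\<^esub> inv\<^bsub>Q\<^esub> \<iota> b = fraction Q \<iota> u v" "v \<noteq> 0"
    by (rule fraction_cases)
  have "\<iota> v \<otimes>\<^bsub>Q\<^esub> (\<iota> a \<otimes>\<^bsub>Q\<^esub> inv\<^bsub>Q\<^esub> \<iota> b) = \<iota> u"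
    unfolding uv by (rule fraction_mult_denominator[OF uv(2)])
  then have "\<iota> v \<otimes>\<^bsub>Q\<^esub> \<iota> a = \<iota> u \<otimes>\<^bsub>Q\<^esub> \<iota> b"
    using b by (metis Q.Units_inv_closed Q.Units_l_inv Q.m_assoc Q.m_closed Q.r_one embed_closed)
  then have "skew_mult \<alpha> \<delta> v a = skew_mult \<alpha> \<delta> u b"
    by (simp add: embed_mult[symmetric])
  with uv that show thesis by blast
qed

text \<open>A common left multiple \<open>v s = u s'\<close> of the denominators yields
  \<open>v r = u r'\<close>; additivity of degrees gives the claim. This makes the
  \<open>THE\<close> in \<open>frac_deg\<close> meaningful.\<close>

lemma fraction_degree_unique:
  assumes "r \<noteq> 0" "s \<noteq> 0" "r' \<noteq> 0" "s' \<noteq> 0" "fraction Q \<iota> r s = fraction Q \<iota> r' s'"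
  shows "int (degree r) - int (degree s) = int (degree r') - int (degree s')"
proof -
  let ?x = "fraction Q \<iota> r s"
  obtain u v where uv: "v \<noteq> 0" "skew_mult \<alpha> \<delta> v s = skew_mult \<alpha> \<delta> u s'"
    using left_ore[OF assms(4)] .
  then have u: "u \<noteq> 0" using skew_mult_nonzero(2)[of v s] assms(2) by (auto simp: skew_mult_def)
  note x = fraction_closed[OF assms(2), of r]
  have "\<iota> (skew_mult \<alpha> \<delta> v r) = \<iota> v \<otimes>\<^bsub>Q\<^esub> (\<iota> s \<otimes>\<^bsub>Q\<^esub> ?x)"
    by (simp only: embed_mult fraction_mult_denominator[OF assms(2)])
  also have "\<dots> = \<iota> (skew_mult \<alpha> \<delta> v s) \<otimes>\<^bsub>Q\<^esub> ?x"
    using x by (simp add: embed_mult Q.m_assoc)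
  also have "\<dots> = \<iota> u \<otimes>\<^bsub>Q\<^esub> (\<iota> s' \<otimes>\<^bsub>Q\<^esub> ?x)"
    using x by (simp add: uv embed_mult Q.m_assoc)
  also have "\<dots> = \<iota> (skew_mult \<alpha> \<delta> u r')"
    by (simp add: embed_mult assms(5) fraction_mult_denominator assms(4))
  finally have "skew_mult \<alpha> \<delta> v r = skew_mult \<alpha> \<delta> u r'" by simp
  then have "degree v + degree r = degree u + degree r'"
    using skew_mult_nonzero(1) uv(1) u assms by metis
  moreover have "degree v + degree s = degree u + degree s'"
    using skew_mult_nonzero(1) uv u assms by metis
  ultimately show ?thesis by linarith
qed

lemma frac_deg_zero: "frac_deg Q \<iota> \<zero>\<^bsub>Q\<^esub> = \<infinity>"
  by (simp add: frac_deg_def)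

lemma frac_deg_fraction:
  assumes "r \<noteq> 0" "s \<noteq> 0"
  shows "frac_deg Q \<iota> (fraction Q \<iota> r s) = Fin (int (degree r) - int (degree s))"
proof -
  have "(THE d. \<exists>r' s'. r' \<noteq> 0 \<and> s' \<noteq> 0 \<and> fraction Q \<iota> r s = fraction Q \<iota> r' s' \<and>
      d = int (degree r') - int (degree s')) = int (degree r) - int (degree s)"
    using assms fraction_degree_unique by (intro the_equality) metis+
  with assms show ?thesis by (simp add: frac_deg_def fraction_zero_iff)
qed

lemma frac_deg_embed: "p \<noteq> 0 \<Longrightarrow> frac_deg Q \<iota> (\<iota> p) = Fin (int (degree p))"
  using frac_deg_fraction[of p 1] eq_fractionI[of "\<iota> p" 1 p] by simp

lemma frac_deg_one: "frac_deg Q \<iota> \<one>\<^bsub>Q\<^esub> = 0"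
  using frac_deg_embed[of 1] by (simp add: zero_extended_def)

lemma frac_deg_Units:
  assumes "x \<in> Units Q"
  obtains d where "frac_deg Q \<iota> x = Fin d"
  using assms fraction_cases[of x] by (auto simp: frac_deg_def Units_Q)

lemma frac_deg_mult:
  assumes "x \<in> carrier Q" "y \<in> carrier Q"
  shows "frac_deg Q \<iota> (x \<otimes>\<^bsub>Q\<^esub> y) = frac_deg Q \<iota> x + frac_deg Q \<iota> y"
proof -
  obtain r s where x: "x = fraction Q \<iota> r s" "s \<noteq> 0" by (rule fraction_cases[OF assms(1)])
  obtain r' s' where y: "y = fraction Q \<iota> r' s'" "s' \<noteq> 0" by (rule fraction_cases[OF assms(2)])
  consider "x = \<zero>\<^bsub>Q\<^esub>" | "y = \<zero>\<^bsub>Q\<^esub>" "x \<noteq> \<zero>\<^bsub>Q\<^esub>" | "r \<noteq> 0" "r' \<noteq> 0"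
    using x y by (auto simp: fraction_zero_iff)
  then show ?thesis
  proof cases
    case 1
    with assms show ?thesis
      by (cases "y = \<zero>\<^bsub>Q\<^esub>") (auto simp: frac_deg_zero frac_deg_def)
  next
    case 2
    with assms show ?thesis by (auto simp: frac_deg_zero frac_deg_def)
  next
    case 3
    \<comment> \<open>To multiply the fractions, the inner numerator \<open>r\<close> must pass the
      denominator \<open>s'\<close>: with \<open>v r = u s'\<close> the product has numerator
      \<open>u r'\<close> and denominator \<open>v s\<close>.\<close>
    obtain u v where uv: "v \<noteq> 0" "skew_mult \<alpha> \<delta> v r = skew_mult \<alpha> \<delta> u s'"
      using left_ore[OF y(2)] .
    then have u: "u \<noteq> 0" using skew_mult_nonzero(2)[of v r] 3 by (auto simp: skew_mult_def)
    have "\<iota> (skew_mult \<alpha> \<delta> v s) \<otimes>\<^bsub>Q\<^esub> (x \<otimes>\<^bsub>Q\<^esub> y) = \<iota> v \<otimes>\<^bsub>Q\<^esub> (\<iota> s \<otimes>\<^bsub>Q\<^esub> x) \<otimes>\<^bsub>Q\<^esub> y"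
      using assms by (simp add: embed_mult Q.m_assoc)
    also have "\<dots> = \<iota> (skew_mult \<alpha> \<delta> v r) \<otimes>\<^bsub>Q\<^esub> y"
      by (simp add: x fraction_mult_denominator embed_mult)
    also have "\<dots> = \<iota> u \<otimes>\<^bsub>Q\<^esub> (\<iota> s' \<otimes>\<^bsub>Q\<^esub> y)"
      using assms by (simp add: uv embed_mult Q.m_assoc)
    also have "\<dots> = \<iota> (skew_mult \<alpha> \<delta> u r')"
      by (simp add: y fraction_mult_denominator embed_mult)
    finally have xy: "x \<otimes>\<^bsub>Q\<^esub> y = fraction Q \<iota> (skew_mult \<alpha> \<delta> u r') (skew_mult \<alpha> \<delta> v s)"
      using assms skew_mult_nonzero(2) uv(1) x(2) by (intro eq_fractionI) auto
    have "degree v + degree r = degree u + degree s'"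
      using uv u 3 y(2) skew_mult_nonzero(1) by metis
    then show ?thesis
      using 3 x y u uv(1) unfolding xy
      by (simp add: x y frac_deg_fraction skew_mult_nonzero)
  qed
qed

section \<open>Passage of the degree to the abelianised unit group\<close>

lemma commutator_units_degree:
  assumes "c \<in> commutator_units Q"
  shows "c \<in> Units Q \<and> frac_deg Q \<iota> c = 0"
proof -
  interpret U: group "units_of Q" by (rule Q.units_group)
  have frac_deg_inv: "frac_deg Q \<iota> (inv\<^bsub>Q\<^esub> x) = Fin (- d)"
    if "x \<in> Units Q" "frac_deg Q \<iota> x = Fin d" for x d
  proof -
    from that(1) obtain e where e: "frac_deg Q \<iota> (inv\<^bsub>Q\<^esub> x) = Fin e"
      by (metis Q.Units_inv_Units frac_deg_Units)
    have "Fin d + Fin e = (0 :: int extended)"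
      using that e frac_deg_mult[OF Q.Units_closed[OF that(1)] Q.Units_inv_closed[OF that(1)]]
      by (simp add: frac_deg_one)
    with e show ?thesis by (simp add: zero_extended_def)
  qed
  \<comment> \<open>Degrees of units lie in the commutative group of integers, so those of
    \<open>g\<close>, \<open>h\<close> and their inverses cancel.\<close>
  have base: "x \<in> Units Q \<and> frac_deg Q \<iota> x = 0"
    if x: "x \<in> derived_set (units_of Q) (carrier (units_of Q))" for x
  proof -
    from x obtain g h where gh: "g \<in> Units Q" "h \<in> Units Q"
      "x = g \<otimes>\<^bsub>Q\<^esub> h \<otimes>\<^bsub>Q\<^esub> inv\<^bsub>Q\<^esub> g \<otimes>\<^bsub>Q\<^esub> inv\<^bsub>Q\<^esub> h"
      by (auto simp: units_of_carrier units_of_mult Q.units_of_inv)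
    obtain d where d: "frac_deg Q \<iota> g = Fin d" by (rule frac_deg_Units[OF gh(1)])
    obtain e where e: "frac_deg Q \<iota> h = Fin e" by (rule frac_deg_Units[OF gh(2)])
    show ?thesis
      using gh d e frac_deg_inv[OF gh(1) d] frac_deg_inv[OF gh(2) e]
      by (simp add: frac_deg_mult Q.Units_m_closed Q.Units_closed zero_extended_def)
  qed
  from assms have "c \<in> generate (units_of Q) (derived_set (units_of Q) (carrier (units_of Q)))"
    by (simp add: commutator_units_def derived_def)
  then show ?thesis
  proof induction
    case one
    then show ?case by (simp add: units_of_one frac_deg_one)
  next
    case (incl h)
    then show ?case by (rule base)
  next
    case (inv h)
    then show ?case
      using base[OF inv] frac_deg_inv[of h 0]
      by (auto simp: Q.units_of_inv zero_extended_def)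
  next
    case (eng h1 h2)
    then show ?case by (auto simp: units_of_mult frac_deg_mult Q.Units_m_closed Q.Units_closed)
  qed
qed

text \<open>Members of a class differ by factors of degree 0, and the class is non-empty, so
  \<open>the_elem\<close> in \<open>ab_deg\<close> is applied to a singleton.\<close>

lemma frac_deg_ab_class:
  assumes "q \<in> carrier Q"
  shows "ab_class Q q \<subseteq> carrier Q" "frac_deg Q \<iota> ` ab_class Q q = {frac_deg Q \<iota> q}"
proof -
  have one: "\<one>\<^bsub>Q\<^esub> \<in> commutator_units Q"
    unfolding commutator_units_def derived_def
    using generate.one[of "units_of Q"] by (simp add: units_of_one)
  have deg: "c \<in> carrier Q \<and> frac_deg Q \<iota> c = 0" if "c \<in> commutator_units Q" for c
    using commutator_units_degree[OF that] by auto
  show "ab_class Q q \<subseteq> carrier Q"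
    using assms deg by (auto simp: ab_class_def r_coset_def units_of_mult)
  have "frac_deg Q \<iota> ` (commutator_units Q #>\<^bsub>units_of Q\<^esub> q) =
      (\<lambda>c. frac_deg Q \<iota> q) ` commutator_units Q"
    using assms deg by (auto simp: r_coset_def units_of_mult frac_deg_mult image_iff)
  with one show "frac_deg Q \<iota> ` ab_class Q q = {frac_deg Q \<iota> q}"
    by (auto simp: ab_class_def)
qed

lemma ab_deg_ab_class: "q \<in> carrier Q \<Longrightarrow> ab_deg Q \<iota> (ab_class Q q) = frac_deg Q \<iota> q"
  by (simp add: ab_deg_def frac_deg_ab_class)

text \<open>It suffices that the degree is constant on the set product; identifying that product as
  a class is avoided, and 0 is treated like the other elements.\<close>

lemma ab_deg_set_mult:
  assumes "x \<in> carrier Q" "y \<in> carrier Q"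
  shows "ab_deg Q \<iota> (ab_class Q x <#>\<^bsub>Q\<^esub> ab_class Q y) = frac_deg Q \<iota> x + frac_deg Q \<iota> y"
proof -
  have "ab_class Q x \<noteq> {}" "ab_class Q y \<noteq> {}"
    using assms frac_deg_ab_class(2) by fastforce+
  moreover have "frac_deg Q \<iota> (a \<otimes>\<^bsub>Q\<^esub> b) = frac_deg Q \<iota> x + frac_deg Q \<iota> y"
    if "a \<in> ab_class Q x" "b \<in> ab_class Q y" for a b
  proof -
    have "a \<in> carrier Q" "b \<in> carrier Q" "frac_deg Q \<iota> a = frac_deg Q \<iota> x"
      "frac_deg Q \<iota> b = frac_deg Q \<iota> y"
      using that frac_deg_ab_class[OF assms(1)] frac_deg_ab_class[OF assms(2)] by blast+
    then show ?thesis by (simp add: frac_deg_mult)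
  qed
  ultimately have "frac_deg Q \<iota> ` (ab_class Q x <#>\<^bsub>Q\<^esub> ab_class Q y) =
      {frac_deg Q \<iota> x + frac_deg Q \<iota> y}"
    by (fastforce simp: set_mult_def image_iff)
  then show ?thesis by (simp add: ab_deg_def)
qed

lemma Q_ab_cases:
  assumes "C \<in> carrier (Q_ab Q)"
  obtains q where "q \<in> carrier Q" "C = ab_class Q q"
proof (cases "C = {\<zero>\<^bsub>Q\<^esub>}")
  case True
  then show ?thesis using that[of "\<zero>\<^bsub>Q\<^esub>"] by (simp add: ab_class_def)
next
  case False
  with assms obtain q where "q \<in> Units Q" "C = commutator_units Q #>\<^bsub>units_of Q\<^esub> q"
    by (auto simp: Q_ab_def FactGroup_def RCOSETS_def units_of_carrier)
  then show ?thesis using that[of q] by (auto simp: ab_class_def Units_Q)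
qed

end

subsection \<open>The degree of the Dieudonne determinant\<close>

text \<open>Non-negativity enters here: if a product has degree 0, so does each factor.\<close>

lemma nat_inf_add_eq_0_iff:
  assumes "x \<in> nat_inf" "y \<in> nat_inf"
  shows "x + y = 0 \<longleftrightarrow> x = 0 \<and> y = 0"
  using assms by (auto simp: nat_inf_def zero_extended_def)

locale skew_dieudonne = skew_fractions \<alpha> \<delta> Q \<iota>
  for \<alpha> \<delta> :: "'k::field \<Rightarrow> 'k" and Q :: "'q ring" and \<iota> :: "'k poly \<Rightarrow> 'q" +
  fixes n :: nat and D :: "'q mat \<Rightarrow> 'q set"
  assumes n_pos: "n \<ge> 1" and dieudonne: "is_dieudonne_det n Q D"
begin

abbreviation F :: "'k poly mat \<Rightarrow> int extended" where
  "F \<equiv> deg_det_restr Q \<iota> D"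

lemma deg_det_mult:
  assumes "A \<in> carrier (matrix_ring n Q)" "B \<in> carrier (matrix_ring n Q)"
  shows "deg_det Q \<iota> D (A \<otimes>\<^bsub>matrix_ring n Q\<^esub> B) = deg_det Q \<iota> D A + deg_det Q \<iota> D B"
proof -
  have hom: "D \<in> hom (matrix_ring n Q) (Q_ab Q)"
    using dieudonne by (simp add: is_dieudonne_det_def)
  obtain x where x: "x \<in> carrier Q" "D A = ab_class Q x"
    using Q_ab_cases[OF hom_in_carrier[OF hom assms(1)]] .
  obtain y where y: "y \<in> carrier Q" "D B = ab_class Q y"
    using Q_ab_cases[OF hom_in_carrier[OF hom assms(2)]] .
  from Group.hom_mult[OF hom assms] show ?thesis
    using x y by (simp add: deg_det_def Q_ab_def ab_deg_set_mult ab_deg_ab_class)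
qed

section \<open>Transfer of matrices from the polynomial ring to its fractions\<close>

lemma embed_finsum: "finite A \<Longrightarrow> \<iota> (finsum P f A) = finsum Q (\<lambda>k. \<iota> (f k)) A"
proof (induction A rule: finite_induct)
  case (insert x A)
  then show ?case
    using P.finsum_insert[of A x f] by (simp add: embed_add Q.finsum_insert)
qed (simp add: P.finsum_empty[simplified])

lemma map_mat_closed:
  "A \<in> carrier (matrix_ring n P) \<Longrightarrow> map_mat \<iota> A \<in> carrier (matrix_ring n Q)"
  by (auto simp: matrix_ring_carrier_iff)

lemma map_mat_mult:
  assumes "A \<in> carrier (matrix_ring n P)" "B \<in> carrier (matrix_ring n P)"
  shows "map_mat \<iota> (A \<otimes>\<^bsub>matrix_ring n P\<^esub> B) =
    map_mat \<iota> A \<otimes>\<^bsub>matrix_ring n Q\<^esub> map_mat \<iota> B"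
proof (rule matrix_ring_eqI)
  fix i j assume "i < n" "j < n"
  then show "map_mat \<iota> (A \<otimes>\<^bsub>matrix_ring n P\<^esub> B) $$ (i, j) =
      (map_mat \<iota> A \<otimes>\<^bsub>matrix_ring n Q\<^esub> map_mat \<iota> B) $$ (i, j)"
    using assms matrix_ring_dim[OF P.matrix_ring_mult_closed[OF assms]]
    by (auto simp: index_matrix_ring_mult embed_finsum embed_mult matrix_ring_dim
        intro!: Q.finsum_cong')
qed (use assms in \<open>auto intro!: map_mat_closed P.matrix_ring_mult_closed
    Q.matrix_ring_mult_closed\<close>)

lemma deg_det_restr_mult:
  assumes "A \<in> carrier (matrix_ring n P)" "B \<in> carrier (matrix_ring n P)"
  shows "F (A \<otimes>\<^bsub>matrix_ring n P\<^esub> B) = F A + F B"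
  using assms by (simp add: deg_det_restr_def map_mat_mult deg_det_mult map_mat_closed)

section \<open>Values on the generators\<close>

lemma deg_det_restr_elementary:
  assumes "i \<noteq> j" "i < n" "j < n"
  shows "F (elementary_matrix n P i j c) = 0"
proof -
  have "map_mat \<iota> (elementary_matrix n P i j c) = elementary_matrix n Q i j (\<iota> c)"
    by (auto simp: elementary_matrix_def)
  moreover have "D (elementary_matrix n Q i j (\<iota> c)) = commutator_units Q"
    using dieudonne assms by (simp add: is_dieudonne_det_def Q_ab_def)
  \<comment> \<open>The unit of \<open>Q_ab\<close> is the class of 1, which brings the prescribed
    value into the form that \<open>ab_deg_ab_class\<close> evaluates.\<close>
  moreover have "commutator_units Q = ab_class Q \<one>\<^bsub>Q\<^esub>"
    using commutator_units_degree one_neq_zero_Q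
    by (force simp: ab_class_def r_coset_def units_of_mult)
  ultimately show ?thesis
    by (simp add: deg_det_restr_def deg_det_def ab_deg_ab_class frac_deg_one)
qed

text \<open>A zero row of \<open>A\<close> persists in every product \<open>A B\<close>, which then
  misses a 1 on the diagonal. Needed because the determinant of a diagonal matrix with entry 0 is
  prescribed only through non-invertibility.\<close>

lemma zero_row_not_GL:
  assumes "i < n" "A \<in> carrier (matrix_ring n Q)" "\<And>j. j < n \<Longrightarrow> A $$ (i, j) = \<zero>\<^bsub>Q\<^esub>"
  shows "A \<notin> GL n Q"
proof
  assume "A \<in> GL n Q"
  then obtain B where B: "B \<in> carrier (matrix_ring n Q)"
    "A \<otimes>\<^bsub>matrix_ring n Q\<^esub> B = \<one>\<^bsub>matrix_ring n Q\<^esub>"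
    by (auto simp: GL_def Units_def)
  have "(A \<otimes>\<^bsub>matrix_ring n Q\<^esub> B) $$ (i, i) = (\<Oplus>\<^bsub>Q\<^esub>k\<in>{..<n}. \<zero>\<^bsub>Q\<^esub>)"
    unfolding index_matrix_ring_mult[OF assms(1,1)]
    using assms matrix_ring_index_closed[OF B(1)] by (intro Q.finsum_cong') auto
  with B(2) one_neq_zero_Q assms(1) show False by (simp add: index_matrix_ring_one Q.finsum_zero)
qed

lemma deg_det_restr_last_dilation:
  "F (dilation_matrix n P (n - 1) d) = (if d = 0 then \<infinity> else Fin (int (degree d)))"
proof -
  have map: "map_mat \<iota> (dilation_matrix n P (n - 1) d) = last_diag_matrix n Q (\<iota> d)"
    by (auto simp: last_diag_matrix_eq_dilation dilation_matrix_def)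
  \<comment> \<open>Two clauses of the definition of \<open>D\<close> meet here: singular matrices
    for \<open>d = 0\<close>, units of \<open>Q\<close> otherwise.\<close>
  have "D (last_diag_matrix n Q (\<iota> d)) = ab_class Q (\<iota> d)"
  proof (cases "d = 0")
    case True
    have "last_diag_matrix n Q (\<iota> d) \<in> carrier (matrix_ring n Q) - GL n Q"
      using n_pos True zero_row_not_GL[of "n - 1" "last_diag_matrix n Q (\<iota> d)"]
      by (auto simp: last_diag_matrix_eq_dilation Q.dilation_matrix_closed index_dilation_matrix)
    with True dieudonne show ?thesis by (simp add: is_dieudonne_det_def)
  next
    case False
    with dieudonne embed_Units show ?thesis by (simp add: is_dieudonne_det_def)
  qed
  then show ?thesis
    by (simp add: map deg_det_restr_def deg_det_def ab_deg_ab_class frac_deg_zero frac_deg_embed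
        del: One_nat_def)
qed

text \<open>The signed swap carries the value from the last place to place \<open>i\<close>. Its own
  degree is 0, so it drops out of both sides even when the value is infinite.\<close>

lemma deg_det_restr_dilation:
  assumes "i < n"
  shows "F (dilation_matrix n P i d) = (if d = 0 then \<infinity> else Fin (int (degree d)))"
proof (cases "i = n - 1")
  case False
  let ?W = "P.signed_swap_matrix n i (n - 1)"
  have ij: "i \<noteq> n - 1" "i < n" "n - 1 < n" using False assms by auto
  have W: "F ?W = 0"
    unfolding P.signed_swap_matrix_def using ij
    by (simp add: deg_det_restr_mult P.matrix_ring_mult_closed P.elementary_matrix_closed
        deg_det_restr_elementary)
  have "F ?W + F (dilation_matrix n P (n - 1) d) = F (dilation_matrix n P i d) + F ?W"
    using P.signed_swap_dilation_commute[of d i "n - 1" n] ij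
    by (simp add: deg_det_restr_mult[symmetric] P.signed_swap_matrix_closed
        P.dilation_matrix_closed)
  with W show ?thesis by (simp add: deg_det_restr_last_dilation del: One_nat_def)
qed (simp only: deg_det_restr_last_dilation)

section \<open>Range and kernel on matrices of skew polynomials\<close>

lemma deg_det_restr_one: "F \<one>\<^bsub>matrix_ring n P\<^esub> = 0"
  using deg_det_restr_last_dilation[of 1] P.dilation_matrix_one[of n "n - 1"]
  by (simp add: zero_extended_def)

text \<open>Over \<open>Q\<close> negative degrees occur. Here the factorisation has all its entries
  in the polynomial ring, and \<open>nat_inf\<close> is closed under addition.\<close>

lemma deg_det_restr_nat_inf:
  assumes "A \<in> carrier (matrix_ring n P)"
  shows "F A \<in> nat_inf"
  using matrix_in_elementary_dilation_products[OF assms]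
proof induction
  case (mult A B)
  then show ?case
    by (auto simp: deg_det_restr_mult P.elementary_dilation_products_closed nat_inf_def
        simp flip: of_nat_add)
qed (auto simp: deg_det_restr_one deg_det_restr_elementary deg_det_restr_dilation nat_inf_def
    zero_extended_def intro: image_eqI[of _ _ 0])

text \<open>An inverse gives two degrees in \<open>nat_inf\<close> with sum 0. Conversely, degree 0
  passes to all factors, and a dilation of degree 0 has a non-zero constant as entry, hence a
  unit.\<close>

lemma deg_det_restr_eq_0_iff:
  assumes "A \<in> carrier (matrix_ring n P)"
  shows "F A = 0 \<longleftrightarrow> A \<in> GL n P"
proof
  assume "A \<in> GL n P"
  then obtain B where "B \<in> carrier (matrix_ring n P)"
    "A \<otimes>\<^bsub>matrix_ring n P\<^esub> B = \<one>\<^bsub>matrix_ring n P\<^esub>"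
    by (auto simp: GL_def Units_def)
  with assms show "F A = 0"
    by (metis deg_det_restr_mult deg_det_restr_nat_inf deg_det_restr_one nat_inf_add_eq_0_iff)
next
  interpret M: monoid "matrix_ring n P" by (rule P.monoid_matrix_ring)
  assume "F A = 0"
  with matrix_in_elementary_dilation_products[OF assms] show "A \<in> GL n P"
  proof induction
    case one
    then show ?case by (simp add: GL_def)
  next
    case (elementary c i j)
    then show ?case by (simp add: GL_def P.elementary_matrix_Units)
  next
    case (dilation d i)
    then have "d \<in> Units P"
      by (intro degree_0_Units) (auto simp: deg_det_restr_dilation zero_extended_def split: if_splits)
    then show ?case by (simp add: GL_def P.dilation_matrix_Units)
  next
    case (mult A B)
    then show ?case
      unfolding GL_def
      by (metis M.Units_m_closed P.elementary_dilation_products_closed deg_det_restr_mult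
          deg_det_restr_nat_inf nat_inf_add_eq_0_iff)
  qed
qed

lemma deg_det_restr_image: "F ` carrier (matrix_ring n P) = nat_inf"
proof
  show "F ` carrier (matrix_ring n P) \<subseteq> nat_inf" using deg_det_restr_nat_inf by auto
next
  have "Fin (int m) = F (dilation_matrix n P (n - 1) (monom 1 m))" for m
    by (simp add: deg_det_restr_last_dilation degree_monom_eq del: One_nat_def)
  moreover have "\<infinity> = F (dilation_matrix n P (n - 1) 0)"
    by (simp add: deg_det_restr_last_dilation del: One_nat_def)
  ultimately show "nat_inf \<subseteq> F ` carrier (matrix_ring n P)"
    using P.dilation_matrix_closed by (auto simp: nat_inf_def intro!: image_eqI)
qed

text \<open>
  Since \<open>diag(p) E(c) = E(p c) diag(p)\<close> even for non-invertible \<open>p \<noteq> 0\<close>, the additive map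
  \<open>c \<mapsto> f (E(c))\<close> is invariant under multiplication by \<open>x\<close> and by \<open>x + 1\<close>, hence zero.
\<close>

lemma hom_elementary_eq_0:
  fixes f :: "'k poly mat \<Rightarrow> int extended"
  assumes range: "f \<in> carrier (matrix_ring n P) \<rightarrow> int_inf"
    and mult: "\<And>A B. A \<in> carrier (matrix_ring n P) \<Longrightarrow> B \<in> carrier (matrix_ring n P) \<Longrightarrow>
      f (A \<otimes>\<^bsub>matrix_ring n P\<^esub> B) = f A + f B"
    and diag: "\<And>A. A \<in> diagonal_matrices n P \<Longrightarrow> f A = F A"
    and ij: "i \<noteq> j" "i < n" "j < n"
  shows "f (elementary_matrix n P i j c) = 0"
proof -
  let ?E = "elementary_matrix n P i j"
  let ?D = "dilation_matrix n P i"
  have E: "?E c \<in> carrier (matrix_ring n P)" and Dc: "?D c \<in> carrier (matrix_ring n P)" for c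
    by (simp_all add: P.elementary_matrix_closed P.dilation_matrix_closed)
  have one: "f \<one>\<^bsub>matrix_ring n P\<^esub> = 0"
    using diag[of "\<one>\<^bsub>matrix_ring n P\<^esub>"] P.matrix_ring_one_closed
    by (simp add: diagonal_matrices_def index_matrix_ring_one deg_det_restr_one)
  have add: "f (?E (a + b)) = f (?E a) + f (?E b)" for a b
    using P.elementary_matrix_add[of a b i j n] ij mult[OF E[of a] E[of b]] by simp
  \<comment> \<open>The values at \<open>a\<close> and \<open>- a\<close> add up to 0, which
    excludes \<infinity>; the value -\<infinity> is excluded by \<open>int_inf\<close>.\<close>
  have "\<exists>z. f (?E a) = Fin z" for a
  proof -
    have "f (?E a) + f (?E (- a)) = 0"
      using add[of a "- a"] one P.elementary_matrix_zero[of n i j] by simp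
    then show ?thesis
      using range E[of a] by (cases "f (?E a)"; cases "f (?E (- a))") (auto simp: zero_extended_def)
  qed
  then obtain z where z: "\<And>a. f (?E a) = Fin (z a)" by metis
  \<comment> \<open>For non-zero \<open>p\<close> the degree of the dilation is finite and can be
    cancelled; for \<open>p = 0\<close> both sides would be infinite.\<close>
  have "z (skew_mult \<alpha> \<delta> p a) = z a" if "p \<noteq> 0" for p a
  proof -
    have "f (?D p) = Fin (int (degree p))"
      using that ij Dc[of p] diag[of "?D p"]
      by (simp add: diagonal_matrices_def index_dilation_matrix deg_det_restr_dilation)
    moreover have "f (?D p) + f (?E a) = f (?E (skew_mult \<alpha> \<delta> p a)) + f (?D p)"
      using P.dilation_elementary_commute[of p a i j n] ij
      by (simp add: mult[symmetric] E Dc)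
    ultimately show ?thesis by (simp add: z)
  qed
  \<comment> \<open>Two non-zero elements with difference 1 are needed. Over the field with two
    elements no constants qualify, but \<open>x + 1\<close> and \<open>x\<close> do over every
    field.\<close>
  from this[of "[:0, 1:] + 1" c] this[of "[:0, 1:]" c]
  have "z (skew_mult \<alpha> \<delta> [:0, 1:] c + c) = z (skew_mult \<alpha> \<delta> [:0, 1:] c)"
    using P.l_distr[of "[:0, 1:]" 1 c] P.l_one[of c] by (simp add: one_pCons)
  with add[of "skew_mult \<alpha> \<delta> [:0, 1:] c" c] have "z c = 0" by (simp add: z)
  then show ?thesis by (simp add: z zero_extended_def)
qed

text \<open>Both maps are multiplicative, so generators suffice: the identity and the dilations are
  diagonal, and elementary matrices have value 0 under both.\<close>

lemma hom_eq_deg_det_restr: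
  fixes f :: "'k poly mat \<Rightarrow> int extended"
  assumes range: "f \<in> carrier (matrix_ring n P) \<rightarrow> int_inf"
    and mult: "\<And>A B. A \<in> carrier (matrix_ring n P) \<Longrightarrow> B \<in> carrier (matrix_ring n P) \<Longrightarrow>
      f (A \<otimes>\<^bsub>matrix_ring n P\<^esub> B) = f A + f B"
    and diag: "\<And>A. A \<in> diagonal_matrices n P \<Longrightarrow> f A = F A"
    and "A \<in> carrier (matrix_ring n P)"
  shows "f A = F A"
  using matrix_in_elementary_dilation_products[OF assms(4)]
proof induction
  case one
  then show ?case
    by (intro diag)
      (simp add: diagonal_matrices_def index_matrix_ring_one P.matrix_ring_one_closed)
next
  case (elementary c i j)
  then show ?case
    using hom_elementary_eq_0[OF range mult diag] by (simp add: deg_det_restr_elementary)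
next
  case (dilation d i)
  then show ?case
    by (intro diag)
      (simp add: diagonal_matrices_def index_dilation_matrix P.dilation_matrix_closed)
next
  case (mult A B)
  then show ?case
    by (simp add: assms(2) deg_det_restr_mult P.elementary_dilation_products_closed)
qed

end

theorem theorem1p1:
  fixes \<alpha> \<delta> :: "'k::field \<Rightarrow> 'k"
    and R :: "'k poly ring"
    and Q :: "'q ring"
    and \<iota> :: "'k poly \<Rightarrow> 'q"
    and n :: nat
    and D :: "'q mat \<Rightarrow> 'q set"
  assumes "field_hom \<alpha>"
    and "alpha_derivation \<alpha> \<delta>"
    and "R = skew_poly_ring \<alpha> \<delta>"
    and "is_skew_field_of_fractions R Q \<iota>"
    and "n \<ge> 1"
    and "is_dieudonne_det n Q D"
  shows
    "(deg_det_restr Q \<iota> D ` carrier (matrix_ring n R) = nat_inf \<and>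
      (\<forall>A \<in> carrier (matrix_ring n R). \<forall>B \<in> carrier (matrix_ring n R).
         deg_det_restr Q \<iota> D (A \<otimes>\<^bsub>matrix_ring n R\<^esub> B) =
         deg_det_restr Q \<iota> D A + deg_det_restr Q \<iota> D B) \<and>
      deg_det_restr Q \<iota> D \<one>\<^bsub>matrix_ring n R\<^esub> = 0 \<and>
      (\<forall>A \<in> carrier (matrix_ring n R). deg_det_restr Q \<iota> D A = 0 \<longleftrightarrow> A \<in> GL n R)) \<and>
     (\<forall>f :: 'k poly mat \<Rightarrow> int extended.
        f \<in> carrier (matrix_ring n R) \<rightarrow> int_inf \<longrightarrow>
        (\<forall>A \<in> carrier (matrix_ring n R). \<forall>B \<in> carrier (matrix_ring n R).
           f (A \<otimes>\<^bsub>matrix_ring n R\<^esub> B) = f A + f B) \<longrightarrow>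
        (\<forall>A \<in> diagonal_matrices n R. f A = deg_det_restr Q \<iota> D A) \<longrightarrow>
        (\<forall>A \<in> carrier (matrix_ring n R). f A = deg_det_restr Q \<iota> D A))"
proof -
  interpret skew_dieudonne \<alpha> \<delta> Q \<iota> n D
    using assms
    by (simp add: skew_dieudonne_def skew_dieudonne_axioms_def skew_fractions_def
        skew_fractions_axioms_def skew_polynomials_def skew_polynomials_axioms_def)
  show ?thesis
    unfolding assms(3)
    using deg_det_restr_image deg_det_restr_mult deg_det_restr_one deg_det_restr_eq_0_iff
      hom_eq_deg_det_restr
    by blast
qed

end
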